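(* Let $d\in\mathbb{N}$ and let $m,n\in\mathbb{N}=\{1,2,\dots\}$ satisfy $$m=\Big\lfloor\frac{n}{48\sqrt2\,\ln(4n)}\Big\rfloor .$$ Then $$e^{\rm ran}(n,d;\Lambda^{\rm std})\le4\,e^{\rm wor}(m,d;\Lambda^{\rm all}).$$ Specifically, if there exist constants $A\ge1$ and $q\in(0,1)$ such that $e^{\rm wor}(k,d;\Lambda^{\rm all})\le A\,q^{k+1}\sqrt{\lambda_{1,d}}$ for all $k\in\mathbb{N}$, then $$e^{\rm ran}(n,d;\Lambda^{\rm std})\le4A\,q_2^{\frac{n}{\ln(4n)}}\sqrt{\lambda_{1,d}},\qquad\text{where } q_2=q^{\frac{1}{48\sqrt2}}\in(q,1).$$
   Context: Setting. For each $d\in\mathbb{N}$, $D_d\subset\mathbb{R}^d$ is a Borel measurable set of positive Lebesgue measure, $\rho_d$ is a probability density function on $D_d$, $G_d=L_2(D_d,\rho_d(x)\,dx)$, and $F_d$ is a separable Hilbert space of functions on $D_d$ that is compactly embedded in $G_d$; ${\rm APP}_d:F_d\to G_d$, ${\rm APP}_d f=f$, is the compact embedding operator. $\lambda_{1,d}$ denotes the largest eigenvalue of $W_d={\rm APP}_d^*\,{\rm APP}_d:F_d\to F_d$, so that $\sqrt{\lambda_{1,d}}=\sup_{\|f\|_{F_d}\le1}\|f\|_{G_d}$. Information. $\Lambda^{\rm all}$ is the extended class of all linear functionals (not necessarily continuous), and $\Lambda^{\rm std}\subset\Lambda^{\rm all}$ is the extended class of all function values $f\mapsto f(x)$, $x\in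 D_d$ (defined only almost everywhere). Worst case setting. Deterministic algorithms have the form $A_{n,d}f=\phi_{n,d}(L_1(f),\dots,L_n(f))$ with linear functionals $L_1,\dots,L_n\in\Lambda^{\rm all}$ and an arbitrary measurable mapping $\phi_{n,d}:\mathbb{R}^n\to G_d$. Define $$e^{\rm wor}(A_{n,d})=\sup_{\|f\|_{F_d}\le1}\|{\rm APP}_d f-A_{n,d}f\|_{G_d},\qquad e^{\rm wor}(n,d;\Lambda^{\rm all})=\inf_{A_{n,d}}e^{\rm wor}(A_{n,d}),$$ the infimum being over all such algorithms. Randomized setting. For $\Lambda\in\{\Lambda^{\rm all},\Lambda^{\rm std}\}$, randomized algorithms have the form $A_{n,d}^\omega(f)=\phi_{n,d,\omega}(L_{1,\omega}(f),\dots,L_{n,\omega}(f))$ with $L_{j,\omega}\in\Lambda$, where $\phi_{n,d,\omega}$ and $L_{j,\omega}$ may be randomly selected according to some probability space $(\Omega,\Sigma,\mathcal P)$; for each fixed $\omega$ the algorithm is a deterministic method with cardinality $n=n(f,\omega)$, which may be random and may depend adaptively on the input. Its cardinality is ${\rm Card}(A_{n,d}^\omega)=\sup_{\|f\|_{F_d}\le1}\mathbb{E}_\omega n(f,\omega)$ and its error is $$e^{\rm ran}(A_{n,d}^\omega)=\sup_{\|f\|_{F_d}\le1}\Big(\mathbb{E}_\omega\|{\rm APP}_d f-A_{n,d}^\omega(f)\|_{G_d}^2\Big)^{1/2}.$$ Define $e^{\rm ran}(n,d;\Lambda)=\inf e^{\rm ran}(A_{n,d}^\omega)$, the infimum being over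 all such algorithms using information from $\Lambda$ with ${\rm Card}(A_{n,d}^\omega)\le n$. $\lfloor x\rfloor$ is the largest integer not exceeding $x$. *)

theory Defs
  imports "HOL-Probability.Probability"
begin

section \<open>The target space \<open>G = L\<^sub>2(D, \<rho>(x) dx)\<close>\<close>

text \<open>
  Elements of \<open>L\<^sub>2\<close> are represented by square-integrable functions; two functions represent the same
  element iff they agree almost everywhere, i.e. iff their \<open>l2_norm\<close>-distance is \<open>0\<close>.
\<close>

definition weighted_measure :: "(real ^ 'd) set \<Rightarrow> (real ^ 'd \<Rightarrow> real) \<Rightarrow> (real ^ 'd) measure" where
  "weighted_measure D \<rho> = density (lebesgue_on D) (\<lambda>x. ennreal (\<rho> x))"

definition L2 :: "'x measure \<Rightarrow> ('x \<Rightarrow> real) set" where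
  "L2 \<mu> = {g \<in> borel_measurable \<mu>. integrable \<mu> (\<lambda>x. (g x)\<^sup>2)}"

definition l2_inner :: "'x measure \<Rightarrow> ('x \<Rightarrow> real) \<Rightarrow> ('x \<Rightarrow> real) \<Rightarrow> real" where
  "l2_inner \<mu> f g = (\<integral>x. f x * g x \<partial>\<mu>)"

definition l2_norm :: "'x measure \<Rightarrow> ('x \<Rightarrow> real) \<Rightarrow> real" where
  "l2_norm \<mu> g = sqrt (l2_inner \<mu> g g)"

definition L2_borel :: "'x measure \<Rightarrow> ('x \<Rightarrow> real) measure" where
  "L2_borel \<mu> = sigma (L2 \<mu>)
     {U. U \<subseteq> L2 \<mu> \<and>
         (\<forall>g\<in>U. \<exists>e>0. \<forall>h\<in>L2 \<mu>. l2_norm \<mu> (\<lambda>x. h x - g x) < e \<longrightarrow> h \<in> U)}"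


section \<open>The source space \<open>F\<close> and the embedding\<close>

definition F_norm :: "(('x \<Rightarrow> real) \<Rightarrow> ('x \<Rightarrow> real) \<Rightarrow> real) \<Rightarrow> ('x \<Rightarrow> real) \<Rightarrow> real" where
  "F_norm ip f = sqrt (ip f f)"

definition unit_ball ::
  "('x \<Rightarrow> real) set \<Rightarrow> (('x \<Rightarrow> real) \<Rightarrow> ('x \<Rightarrow> real) \<Rightarrow> real) \<Rightarrow> ('x \<Rightarrow> real) set" where
  "unit_ball F ip = {f \<in> F. F_norm ip f \<le> 1}"

text \<open>
  \<open>F\<close> is a linear space of functions on \<open>D\<close> with inner product \<open>ip\<close>.  As in \<open>G\<close>, functions that agree
  almost everywhere are identified (\<open>ip_eq_0_iff\<close>), which is also the injectivity of the embedding.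
  This covers Hilbert spaces of genuine functions, where no two distinct members agree almost
  everywhere, as well as Hilbert spaces of classes of functions, where \<open>F\<close> consists of
  representatives.  The values of the members of \<open>F\<close> outside of \<open>D\<close> are irrelevant.
  Compactness of the embedding: every bounded sequence of \<open>F\<close> has a subsequence converging in \<open>G\<close>.
\<close>

locale approximation_setting =
  fixes D :: "(real ^ 'd) set"
    and \<rho> :: "real ^ 'd \<Rightarrow> real"
    and F :: "(real ^ 'd \<Rightarrow> real) set"
    and ip :: "(real ^ 'd \<Rightarrow> real) \<Rightarrow> (real ^ 'd \<Rightarrow> real) \<Rightarrow> real"
  assumes D_borel: "D \<in> sets borel"
    and D_pos: "emeasure lborel D > 0"
    and \<rho>_measurable: "\<rho> \<in> borel_measurable (lebesgue_on D)"
    and \<rho>_nonneg: "x \<in> D \<Longrightarrow> \<rho> x \<ge> 0"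
    and \<rho>_integral: "(\<integral>\<^sup>+x. ennreal (\<rho> x) \<partial>lebesgue_on D) = 1"
    and F_zero: "(\<lambda>x. 0) \<in> F"
    and F_add: "f \<in> F \<Longrightarrow> g \<in> F \<Longrightarrow> (\<lambda>x. f x + g x) \<in> F"
    and F_scale: "f \<in> F \<Longrightarrow> (\<lambda>x. c * f x) \<in> F"
    and ip_commute: "f \<in> F \<Longrightarrow> g \<in> F \<Longrightarrow> ip f g = ip g f"
    and ip_add_left: "f \<in> F \<Longrightarrow> g \<in> F \<Longrightarrow> h \<in> F \<Longrightarrow> ip (\<lambda>x. f x + g x) h = ip f h + ip g h"
    and ip_scale_left: "f \<in> F \<Longrightarrow> g \<in> F \<Longrightarrow> ip (\<lambda>x. c * f x) g = c * ip f g"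
    and ip_nonneg: "f \<in> F \<Longrightarrow> ip f f \<ge> 0"
    and ip_eq_0_iff: "f \<in> F \<Longrightarrow> ip f f = 0 \<longleftrightarrow> (AE x in weighted_measure D \<rho>. f x = 0)"
    and F_complete: "(\<And>i. X i \<in> F) \<Longrightarrow>
          (\<And>e. e > 0 \<Longrightarrow> \<exists>N. \<forall>i\<ge>N. \<forall>j\<ge>N. F_norm ip (\<lambda>x. X i x - X j x) < e) \<Longrightarrow>
          \<exists>f\<in>F. (\<lambda>i. F_norm ip (\<lambda>x. X i x - f x)) \<longlonglongrightarrow> 0"
    and F_separable: "\<exists>S. countable S \<and> S \<subseteq> F \<and>
          (\<forall>f\<in>F. \<forall>e>0. \<exists>s\<in>S. F_norm ip (\<lambda>x. f x - s x) < e)"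
    and F_subset: "F \<subseteq> L2 (weighted_measure D \<rho>)"
    and F_compact: "(\<And>i. X i \<in> F) \<Longrightarrow> (\<And>i. F_norm ip (X i) \<le> C) \<Longrightarrow>
          \<exists>r g. strict_mono r \<and> g \<in> L2 (weighted_measure D \<rho>) \<and>
            (\<lambda>i. l2_norm (weighted_measure D \<rho>) (\<lambda>x. X (r i) x - g x)) \<longlonglongrightarrow> 0"

text \<open>
  \<open>app_adjoint\<close> is the Hilbert space adjoint \<open>APP\<^sup>* : G \<rightarrow> F\<close> of \<open>APP f = f\<close>; its value is determined up
  to equality in \<open>F\<close>.
\<close>

definition app_adjoint ::
  "'x measure \<Rightarrow> ('x \<Rightarrow> real) set \<Rightarrow> (('x \<Rightarrow> real) \<Rightarrow> ('x \<Rightarrow> real) \<Rightarrow> real)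
     \<Rightarrow> ('x \<Rightarrow> real) \<Rightarrow> ('x \<Rightarrow> real)" where
  "app_adjoint \<mu> F ip g = (SOME h. h \<in> F \<and> (\<forall>f\<in>F. ip f h = l2_inner \<mu> f g))"

definition W_op ::
  "'x measure \<Rightarrow> ('x \<Rightarrow> real) set \<Rightarrow> (('x \<Rightarrow> real) \<Rightarrow> ('x \<Rightarrow> real) \<Rightarrow> real)
     \<Rightarrow> ('x \<Rightarrow> real) \<Rightarrow> ('x \<Rightarrow> real)" where
  "W_op \<mu> F ip f = app_adjoint \<mu> F ip f"

definition W_eigenvalue ::
  "'x measure \<Rightarrow> ('x \<Rightarrow> real) set \<Rightarrow> (('x \<Rightarrow> real) \<Rightarrow> ('x \<Rightarrow> real) \<Rightarrow> real) \<Rightarrow> real \<Rightarrow> bool" where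
  "W_eigenvalue \<mu> F ip c \<longleftrightarrow>
     (\<exists>f\<in>F. F_norm ip f \<noteq> 0 \<and> F_norm ip (\<lambda>x. W_op \<mu> F ip f x - c * f x) = 0)"

text \<open>
  The operator \<open>W\<close> has no eigenvalue only if \<open>F\<close> is the zero space; there the convention \<open>\<lambda>\<^sub>1 = 0\<close>
  keeps \<open>sqrt \<lambda>\<^sub>1\<close> equal to the norm of the embedding.
\<close>

definition lambda1 ::
  "'x measure \<Rightarrow> ('x \<Rightarrow> real) set \<Rightarrow> (('x \<Rightarrow> real) \<Rightarrow> ('x \<Rightarrow> real) \<Rightarrow> real) \<Rightarrow> real" where
  "lambda1 \<mu> F ip =
     (if \<exists>c. W_eigenvalue \<mu> F ip c then (GREATEST c. W_eigenvalue \<mu> F ip c) else 0)"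


section \<open>Information\<close>

definition Lambda_all :: "('x \<Rightarrow> real) set \<Rightarrow> (('x \<Rightarrow> real) \<Rightarrow> real) set" where
  "Lambda_all F =
     {L. (\<forall>f\<in>F. \<forall>g\<in>F. L (\<lambda>x. f x + g x) = L f + L g) \<and> (\<forall>c. \<forall>f\<in>F. L (\<lambda>x. c * f x) = c * L f)}"

definition Lambda_std :: "'x set \<Rightarrow> (('x \<Rightarrow> real) \<Rightarrow> real) set" where
  "Lambda_std D = (\<lambda>x f. f x) ` D"


section \<open>Worst case setting\<close>

definition wor_error ::
  "'x measure \<Rightarrow> ('x \<Rightarrow> real) set \<Rightarrow> (('x \<Rightarrow> real) \<Rightarrow> ('x \<Rightarrow> real) \<Rightarrow> real)
     \<Rightarrow> (('x \<Rightarrow> real) \<Rightarrow> ('x \<Rightarrow> real)) \<Rightarrow> ennreal" where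
  "wor_error \<mu> F ip A = (SUP f\<in>unit_ball F ip. ennreal (l2_norm \<mu> (\<lambda>x. f x - A f x)))"

definition wor_algorithms ::
  "'x measure \<Rightarrow> ('x \<Rightarrow> real) set \<Rightarrow> nat \<Rightarrow> (('x \<Rightarrow> real) \<Rightarrow> ('x \<Rightarrow> real)) set" where
  "wor_algorithms \<mu> F n =
     {(\<lambda>f. \<phi> (\<lambda>j\<in>{..<n}. L j f)) | \<phi> L.
        (\<forall>j<n. L j \<in> Lambda_all F) \<and> \<phi> \<in> (\<Pi>\<^sub>M j\<in>{..<n}. borel) \<rightarrow>\<^sub>M L2_borel \<mu>}"

definition e_wor ::
  "'x measure \<Rightarrow> ('x \<Rightarrow> real) set \<Rightarrow> (('x \<Rightarrow> real) \<Rightarrow> ('x \<Rightarrow> real) \<Rightarrow> real) \<Rightarrow> nat \<Rightarrow> ennreal" where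
  "e_wor \<mu> F ip n = (INF A\<in>wor_algorithms \<mu> F n. wor_error \<mu> F ip A)"


section \<open>Randomized setting\<close>

text \<open>
  A deterministic, possibly adaptive, algorithm: the next functional (\<open>query\<close>), the decision to stop
  and the output depend on the list of the values obtained so far, in the order of evaluation.
\<close>

datatype 'x algorithm = Algorithm
  (query: "real list \<Rightarrow> ('x \<Rightarrow> real) \<Rightarrow> real")
  (stop: "real list \<Rightarrow> bool")
  (out: "real list \<Rightarrow> 'x \<Rightarrow> real")

primrec obs :: "'x algorithm \<Rightarrow> ('x \<Rightarrow> real) \<Rightarrow> nat \<Rightarrow> real list" where
  "obs a f 0 = []"
| "obs a f (Suc k) = obs a f k @ [query a (obs a f k) f]"

definition cardinality :: "'x algorithm \<Rightarrow> ('x \<Rightarrow> real) \<Rightarrow> nat" where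
  "cardinality a f = (LEAST k. stop a (obs a f k))"

definition run :: "'x algorithm \<Rightarrow> ('x \<Rightarrow> real) \<Rightarrow> 'x \<Rightarrow> real" where
  "run a f = out a (obs a f (cardinality a f))"

definition det_algorithm ::
  "'x measure \<Rightarrow> ('x \<Rightarrow> real) set \<Rightarrow> (('x \<Rightarrow> real) \<Rightarrow> real) set \<Rightarrow> 'x algorithm \<Rightarrow> bool" where
  "det_algorithm \<mu> F \<Lambda> a \<longleftrightarrow>
     (\<forall>y. query a y \<in> \<Lambda>) \<and>
     (\<forall>f\<in>F. \<exists>k. stop a (obs a f k)) \<and>
     (\<forall>k. (\<lambda>y. out a (map y [0..<k])) \<in> (\<Pi>\<^sub>M j\<in>{..<k}. borel) \<rightarrow>\<^sub>M L2_borel \<mu>)"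

definition ennreal_sqrt :: "ennreal \<Rightarrow> ennreal" where
  "ennreal_sqrt t = (if t = \<top> then \<top> else ennreal (sqrt (enn2real t)))"

definition ran_card ::
  "('x \<Rightarrow> real) set \<Rightarrow> (('x \<Rightarrow> real) \<Rightarrow> ('x \<Rightarrow> real) \<Rightarrow> real)
     \<Rightarrow> 'w measure \<Rightarrow> ('w \<Rightarrow> 'x algorithm) \<Rightarrow> ennreal" where
  "ran_card F ip P A = (SUP f\<in>unit_ball F ip. \<integral>\<^sup>+\<omega>. of_nat (cardinality (A \<omega>) f) \<partial>P)"

definition ran_error ::
  "'x measure \<Rightarrow> ('x \<Rightarrow> real) set \<Rightarrow> (('x \<Rightarrow> real) \<Rightarrow> ('x \<Rightarrow> real) \<Rightarrow> real)
     \<Rightarrow> 'w measure \<Rightarrow> ('w \<Rightarrow> 'x algorithm) \<Rightarrow> ennreal" where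
  "ran_error \<mu> F ip P A =
     (SUP f\<in>unit_ball F ip.
        ennreal_sqrt (\<integral>\<^sup>+\<omega>. ennreal ((l2_norm \<mu> (\<lambda>x. f x - run (A \<omega>) f x))\<^sup>2) \<partial>P))"

text \<open>The two measurability conditions are what the expectations of the cardinality and of the
  squared error need in order to be defined.\<close>

definition ran_algorithm ::
  "'x measure \<Rightarrow> ('x \<Rightarrow> real) set \<Rightarrow> (('x \<Rightarrow> real) \<Rightarrow> real) set
     \<Rightarrow> 'w measure \<Rightarrow> ('w \<Rightarrow> 'x algorithm) \<Rightarrow> bool" where
  "ran_algorithm \<mu> F \<Lambda> P A \<longleftrightarrow>
     prob_space P \<and>
     (\<forall>\<omega>\<in>space P. det_algorithm \<mu> F \<Lambda> (A \<omega>)) \<and>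
     (\<forall>f\<in>F. (\<lambda>\<omega>. cardinality (A \<omega>) f) \<in> P \<rightarrow>\<^sub>M count_space UNIV) \<and>
     (\<forall>f\<in>F. (\<lambda>\<omega>. l2_norm \<mu> (\<lambda>x. f x - run (A \<omega>) f x)) \<in> borel_measurable P)"

text \<open>
  The infimum ranges over all probability spaces on the type of algorithms.  This is no restriction:
  a randomized algorithm on a probability space over any other type has the same cardinality and
  error as its image under \<open>\<omega> \<mapsto> A \<omega>\<close>; see \<open>e_ran_le\<close> below.
\<close>

definition e_ran ::
  "'x measure \<Rightarrow> ('x \<Rightarrow> real) set \<Rightarrow> (('x \<Rightarrow> real) \<Rightarrow> ('x \<Rightarrow> real) \<Rightarrow> real)
     \<Rightarrow> (('x \<Rightarrow> real) \<Rightarrow> real) set \<Rightarrow> nat \<Rightarrow> ennreal" where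
  "e_ran \<mu> F ip \<Lambda> n =
     (INF (P, A) \<in> {(P :: 'x algorithm measure, A :: 'x algorithm \<Rightarrow> 'x algorithm).
          ran_algorithm \<mu> F \<Lambda> P A \<and> ran_card F ip P A \<le> of_nat n}.
        ran_error \<mu> F ip P A)"

lemma e_ran_le:
  fixes P :: "'w measure" and A :: "'w \<Rightarrow> 'x algorithm"
  assumes alg: "ran_algorithm \<mu> F \<Lambda> P A" and card: "ran_card F ip P A \<le> of_nat n"
  shows "e_ran \<mu> F ip \<Lambda> n \<le> ran_error \<mu> F ip P A"
proof -
  define S where "S = {B. B \<subseteq> A ` space P \<and> A -` B \<inter> space P \<in> sets P}"
  have sa: "sigma_algebra (A ` space P) S"
    unfolding sigma_algebra_iff2
  proof (intro conjI ballI allI impI)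
    show "S \<subseteq> Pow (A ` space P)" by (auto simp: S_def)
    show "{} \<in> S" by (simp add: S_def)
  next
    fix B assume B: "B \<in> S"
    have "A -` (A ` space P - B) \<inter> space P = space P - (A -` B \<inter> space P)" by auto
    then show "A ` space P - B \<in> S" using B by (auto simp: S_def)
  next
    fix B :: "nat \<Rightarrow> 'x algorithm set" assume B: "range B \<subseteq> S"
    have "A -` (\<Union>i. B i) \<inter> space P = (\<Union>i. A -` B i \<inter> space P)" by auto
    also have "\<dots> \<in> sets P" using B by (intro sets.countable_UN) (auto simp: S_def)
    finally have "A -` (\<Union>i. B i) \<inter> space P \<in> sets P" .
    moreover have "B i \<subseteq> A ` space P" for i
      using subsetD[OF B rangeI, of i] by (simp add: S_def)
    ultimately show "(\<Union>i. B i) \<in> S" unfolding S_def by blast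
  qed
  define N where "N = sigma (A ` space P) S"
  have spN: "space N = A ` space P" and setN: "sets N = S"
    using sigma_algebra.sets_measure_of_eq[OF sa] sigma_algebra.space_measure_of_eq[OF sa]
    by (simp_all add: N_def)
  have A: "A \<in> P \<rightarrow>\<^sub>M N"
    by (rule measurableI) (auto simp: spN setN S_def)
  have lift: "h \<in> N \<rightarrow>\<^sub>M K" if "(\<lambda>\<omega>. h (A \<omega>)) \<in> P \<rightarrow>\<^sub>M K" for h and K :: "'k measure"
  proof (rule measurableI)
    fix a assume "a \<in> space N"
    then show "h a \<in> space K" using measurable_space[OF that] by (auto simp: spN)
  next
    fix B assume "B \<in> sets K"
    from measurable_sets[OF that this]
    have "(\<lambda>\<omega>. h (A \<omega>)) -` B \<inter> space P \<in> sets P" .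
    also have "(\<lambda>\<omega>. h (A \<omega>)) -` B \<inter> space P = A -` (h -` B \<inter> space N) \<inter> space P"
      by (auto simp: spN)
    finally show "h -` B \<inter> space N \<in> sets N"
      by (auto simp: setN spN S_def)
  qed
  define Q where "Q = distr P N A"
  have P: "prob_space P"
    and det: "\<And>\<omega>. \<omega> \<in> space P \<Longrightarrow> det_algorithm \<mu> F \<Lambda> (A \<omega>)"
    and mc: "\<And>f. f \<in> F \<Longrightarrow> (\<lambda>\<omega>. cardinality (A \<omega>) f) \<in> P \<rightarrow>\<^sub>M count_space UNIV"
    and me: "\<And>f. f \<in> F \<Longrightarrow> (\<lambda>\<omega>. l2_norm \<mu> (\<lambda>x. f x - run (A \<omega>) f x)) \<in> borel_measurable P"
    using alg by (auto simp: ran_algorithm_def)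
  have mcN: "(\<lambda>a. cardinality a f) \<in> N \<rightarrow>\<^sub>M count_space UNIV" if "f \<in> F" for f
    using mc[OF that] by (rule lift)
  have meN: "(\<lambda>a. l2_norm \<mu> (\<lambda>x. f x - run a f x)) \<in> borel_measurable N" if "f \<in> F" for f
    using me[OF that] by (rule lift)
  have "ran_algorithm \<mu> F \<Lambda> Q (\<lambda>a. a)"
    unfolding ran_algorithm_def Q_def
    using prob_space.prob_space_distr[OF P A] det mcN meN by (auto simp: spN)
  moreover have "ran_card F ip Q (\<lambda>a. a) = ran_card F ip P A"
    unfolding ran_card_def
  proof (rule SUP_cong[OF refl])
    fix f assume "f \<in> unit_ball F ip"
    then have f: "f \<in> F" by (simp add: unit_ball_def)
    have "(\<lambda>a. of_nat (cardinality a f) :: ennreal) \<in> borel_measurable N"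
      using mcN[OF f] by measurable
    then show "(\<integral>\<^sup>+a. of_nat (cardinality a f) \<partial>Q) = (\<integral>\<^sup>+\<omega>. of_nat (cardinality (A \<omega>) f) \<partial>P)"
      unfolding Q_def by (subst nn_integral_distr[OF A]) auto
  qed
  moreover have "ran_error \<mu> F ip Q (\<lambda>a. a) = ran_error \<mu> F ip P A"
    unfolding ran_error_def
  proof (rule SUP_cong[OF refl])
    fix f assume "f \<in> unit_ball F ip"
    then have f: "f \<in> F" by (simp add: unit_ball_def)
    have "(\<lambda>a. ennreal ((l2_norm \<mu> (\<lambda>x. f x - run a f x))\<^sup>2)) \<in> borel_measurable N"
      using meN[OF f] by measurable
    then show "ennreal_sqrt (\<integral>\<^sup>+a. ennreal ((l2_norm \<mu> (\<lambda>x. f x - run a f x))\<^sup>2) \<partial>Q) =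
        ennreal_sqrt (\<integral>\<^sup>+\<omega>. ennreal ((l2_norm \<mu> (\<lambda>x. f x - run (A \<omega>) f x))\<^sup>2) \<partial>P)"
      unfolding Q_def by (subst nn_integral_distr[OF A]) auto
  qed
  ultimately show ?thesis
    using card unfolding e_ran_def
    by (intro INF_lower2[where i = "(Q, \<lambda>a. a)"]) auto
qed

end

theory Submission
  imports Defs
begin

text \<open>
  The theorem compares two numbers, and a subspace of dimension at most \<open>m\<close> links them.

  Lower bound.  Let \<open>s\<close> exceed the worst case error of some algorithm that uses linear functionals
  \<open>L\<^sub>1, \<dots>, L\<^sub>m\<close>, and let \<open>K\<close> be their common kernel.  The algorithm cannot tell \<open>k \<in> K\<close> from \<open>-k\<close>, so
  every \<open>k \<in> K\<close> in the unit ball of \<open>F\<close> has \<open>G\<close>-norm at most \<open>s\<close>.  The \<open>F\<close>-orthogonal complement of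
  \<open>K\<close> has dimension at most \<open>m\<close>, also if some of the functionals are discontinuous; and what remains
  of \<open>f\<close> after projection onto that complement lies in the closure of \<open>K\<close>, so its \<open>G\<close>-norm is at most
  \<open>s\<close> because the embedding is bounded.  Orthonormalizing the complement in \<open>G\<close> yields
  \<open>b\<^sub>0, \<dots>, b\<^bsub>r-1\<^esub>\<close>, \<open>r \<le> m\<close>, such that the residual \<open>g = f - P f\<close> of the \<open>G\<close>-orthogonal projection \<open>P\<close> on
  their span has norm at most \<open>s\<close> for all \<open>f\<close> in the unit ball (\<open>best_subspace\<close>).

  Upper bound.  It suffices to recover the \<open>r\<close> coefficients of \<open>P f\<close> from function values, up to a mean
  square error comparable to \<open>\<parallel>g\<parallel>\<^sup>2\<close>.  This is done in two stages.

  \<^item> The first \<open>r\<close> points have the joint density \<open>det (b\<^sub>i(x\<^sub>j))\<^sup>2 / r!\<close>, and \<open>f\<close> is interpolated there.  The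
    interpolation is exact on the span of the \<open>b\<^sub>i\<close>, so its error depends on \<open>g\<close> only.  By Cramer's rule
    the error of one coefficient is a quotient of determinants; the density cancels the
    denominator, and the orthogonality of the rows evaluates the numerator to \<open>\<parallel>g\<parallel>\<^sup>2\<close>.  Hence the
    expected squared error of all coefficients is at most \<open>r \<parallel>g\<parallel>\<^sup>2\<close> (\<open>cramer_start_expectation\<close>).

  \<^item> Each further point is drawn with density \<open>(1 + |b(x)|\<^sup>2) / (1 + r)\<close> and used for one regularized
    Kaczmarz step \<open>c \<leftarrow> c + (f(x) - c \<bullet> b(x)) b(x) / (1 + |b(x)|\<^sup>2)\<close>.  A step maps the expected squared error
    \<open>E\<close> to at most \<open>a E + (1 - a) \<parallel>g\<parallel>\<^sup>2\<close> with \<open>a = 1 - 1/(1 + r)\<close> (\<open>kaczmarz_step_expectation\<close>).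

  After \<open>N\<close> steps the squared error is at most \<open>(2 + r a\<^sup>N) \<parallel>g\<parallel>\<^sup>2\<close> in expectation, and about \<open>r ln r\<close>
  steps, which the relation between \<open>m\<close> and \<open>n\<close> amply provides, make \<open>r a\<^sup>N \<le> 1\<close>.  The randomized error is
  thus at most \<open>2 s\<close>, which leaves a factor \<open>2\<close> to spare.  The point of the first stage is that it
  removes the dependence on \<open>P f\<close>, which may be much larger than \<open>g\<close>; the factor \<open>r\<close> that it loses
  costs only logarithmically many steps per dimension.

  The second claim follows from the first since \<open>m + 1\<close> exceeds \<open>n / (48 \<surd>2 ln (4n))\<close>.
\<close>

section \<open>Linear systems and quadratic polynomials\<close>

text \<open>
  Gaussian elimination of one unknown, for an arbitrary finite index set so that the pivot can be
  removed from it.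
\<close>
lemma underdetermined_system:
  fixes M :: "nat \<Rightarrow> 'i \<Rightarrow> real"
  assumes "finite I" and "m < card I"
  shows "\<exists>a. (\<exists>i\<in>I. a i \<noteq> 0) \<and> (\<forall>j<m. (\<Sum>i\<in>I. a i * M j i) = 0)"
  using assms
proof (induction m arbitrary: I M)
  case 0
  then obtain i where "i \<in> I" by (metis card.empty ex_in_conv less_irrefl)
  then show ?case by (intro exI[of _ "\<lambda>_. 1"]) auto
next
  case (Suc m)
  show ?case
  proof (cases "\<forall>i\<in>I. M m i = 0")
    case True
    from Suc.IH[of I M] Suc.prems obtain a
      where a: "\<exists>i\<in>I. a i \<noteq> 0" "\<forall>j<m. (\<Sum>i\<in>I. a i * M j i) = 0" by auto
    with True show ?thesis by (intro exI[of _ a]) (auto simp: less_Suc_eq)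
  next
    case False
    then obtain p where p: "p \<in> I" "M m p \<noteq> 0" by auto
    define I' where "I' = I - {p}"
    have I': "finite I'" "m < card I'" "p \<notin> I'" using Suc.prems p by (auto simp: I'_def)
    have I_eq: "I = insert p I'" using p by (auto simp: I'_def)
    from Suc.IH[OF I'(1,2), of "\<lambda>j i. M j i - M j p * M m i / M m p"] obtain a
      where a: "\<exists>i\<in>I'. a i \<noteq> 0"
        "\<And>j. j < m \<Longrightarrow> (\<Sum>i\<in>I'. a i * (M j i - M j p * M m i / M m p)) = 0" by auto
    \<comment> \<open>The value at the pivot is chosen to satisfy equation \<open>m\<close>.\<close>
    define a' where "a' = a(p := - (\<Sum>i\<in>I'. a i * M m i) / M m p)"
    have sum: "(\<Sum>i\<in>I. a' i * M j i)
        = (\<Sum>i\<in>I'. a i * M j i) - (\<Sum>i\<in>I'. a i * M m i) / M m p * M j p" for j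
    proof -
      have "(\<Sum>i\<in>I'. a' i * M j i) = (\<Sum>i\<in>I'. a i * M j i)"
        using I' by (intro sum.cong) (auto simp: a'_def)
      then show ?thesis using I' by (simp add: I_eq) (simp add: a'_def)
    qed
    have "(\<Sum>i\<in>I. a' i * M j i) = 0" if "j < Suc m" for j
    proof (cases "j = m")
      case True
      then show ?thesis using sum[of m] p by simp
    next
      case False
      then have "(\<Sum>i\<in>I'. a i * M j i) = (\<Sum>i\<in>I'. a i * (M j p * M m i / M m p))"
        using a(2)[of j] that by (simp add: right_diff_distrib sum_subtractf)
      also have "\<dots> = (\<Sum>i\<in>I'. a i * M m i) / M m p * M j p"
        by (simp add: sum_distrib_left sum_distrib_right sum_divide_distrib mult_ac)
      finally show ?thesis using sum[of j] by simp
    qed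
    moreover have "\<exists>i\<in>I. a' i \<noteq> 0"
      using a(1) I'(3) by (auto simp: a'_def I_eq)
    ultimately show ?thesis by blast
  qed
qed

text \<open>
  With \<open>A = \<langle>f, f\<rangle>\<close>, \<open>B = \<langle>f, g\<rangle>\<close>, \<open>C = \<langle>g, g\<rangle>\<close> this is the Cauchy-Schwarz inequality.  In the
  orthogonal projection the same statement is applied with a small \<open>A\<close>, to show that approximate
  minimizers are approximately orthogonal.
\<close>
lemma quadratic_nonneg_imp_discriminant:
  fixes A B C :: real
  assumes "\<And>t. A - 2 * t * B + t\<^sup>2 * C \<ge> 0" and "C \<ge> 0"
  shows "B\<^sup>2 \<le> A * C"
proof (cases "C = 0")
  case True
  have "B = 0"
  proof (rule ccontr)
    assume "B \<noteq> 0"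
    with assms(1)[of "(A + 1) / (2 * B)"] True show False by simp
  qed
  with True show ?thesis by simp
next
  case False
  with assms(2) have "C > 0" by simp
  have "A - 2 * (B / C) * B + (B / C)\<^sup>2 * C = A - B\<^sup>2 / C"
    using False by (simp add: power2_eq_square field_simps)
  then have "B\<^sup>2 / C \<le> A" using assms(1)[of "B / C"] by simp
  then show ?thesis using \<open>C > 0\<close> by (simp add: divide_le_eq)
qed

section \<open>Inner product spaces of functions\<close>

definition orthonormal ::
  "('x \<Rightarrow> real) set \<Rightarrow> (('x \<Rightarrow> real) \<Rightarrow> ('x \<Rightarrow> real) \<Rightarrow> real) \<Rightarrow> nat \<Rightarrow> (nat \<Rightarrow> 'x \<Rightarrow> real) \<Rightarrow> bool" where
  "orthonormal S ip r b \<longleftrightarrow>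
     (\<forall>i<r. b i \<in> S) \<and> (\<forall>i<r. \<forall>j<r. ip (b i) (b j) = (if i = j then 1 else 0))"

definition residual ::
  "(('x \<Rightarrow> real) \<Rightarrow> ('x \<Rightarrow> real) \<Rightarrow> real) \<Rightarrow> nat \<Rightarrow> (nat \<Rightarrow> 'x \<Rightarrow> real) \<Rightarrow> ('x \<Rightarrow> real) \<Rightarrow> 'x \<Rightarrow> real" where
  "residual ip r b f = (\<lambda>x. f x - (\<Sum>i<r. ip f (b i) * b i x))"

text \<open>
  Both \<open>F\<close> and \<open>L\<^sub>2\<close> are sets of functions with a positive semidefinite form; only functions at
  distance zero, not necessarily equal functions, are identified.  The locale covers both.
\<close>
locale function_inner_space =
  fixes S :: "('x \<Rightarrow> real) set" and ip :: "('x \<Rightarrow> real) \<Rightarrow> ('x \<Rightarrow> real) \<Rightarrow> real"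
  assumes zero_in: "(\<lambda>x. 0) \<in> S"
    and add_in: "f \<in> S \<Longrightarrow> g \<in> S \<Longrightarrow> (\<lambda>x. f x + g x) \<in> S"
    and scale_in: "f \<in> S \<Longrightarrow> (\<lambda>x. c * f x) \<in> S"
    and commute: "f \<in> S \<Longrightarrow> g \<in> S \<Longrightarrow> ip f g = ip g f"
    and add_left: "f \<in> S \<Longrightarrow> g \<in> S \<Longrightarrow> h \<in> S \<Longrightarrow> ip (\<lambda>x. f x + g x) h = ip f h + ip g h"
    and scale_left: "f \<in> S \<Longrightarrow> g \<in> S \<Longrightarrow> ip (\<lambda>x. c * f x) g = c * ip f g"
    and nonneg: "f \<in> S \<Longrightarrow> ip f f \<ge> 0"
begin

lemma diff_in: "f \<in> S \<Longrightarrow> g \<in> S \<Longrightarrow> (\<lambda>x. f x - g x) \<in> S"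
  using add_in[of f "\<lambda>x. -1 * g x"] scale_in[of g "-1"] by simp

lemma diff_left: "f \<in> S \<Longrightarrow> g \<in> S \<Longrightarrow> h \<in> S \<Longrightarrow> ip (\<lambda>x. f x - g x) h = ip f h - ip g h"
  using add_left[of f "\<lambda>x. -1 * g x" h] scale_in[of g "-1"] scale_left[of g h "-1"] by simp

lemma add_right: "f \<in> S \<Longrightarrow> g \<in> S \<Longrightarrow> h \<in> S \<Longrightarrow> ip h (\<lambda>x. f x + g x) = ip h f + ip h g"
  using add_left[of f g h] commute add_in by simp

lemma diff_right: "f \<in> S \<Longrightarrow> g \<in> S \<Longrightarrow> h \<in> S \<Longrightarrow> ip h (\<lambda>x. f x - g x) = ip h f - ip h g"
  using diff_left[of f g h] commute diff_in by simp

lemma scale_right: "f \<in> S \<Longrightarrow> g \<in> S \<Longrightarrow> ip g (\<lambda>x. c * f x) = c * ip g f"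
  using scale_left[of f g c] commute scale_in by simp

lemma zero_left: "f \<in> S \<Longrightarrow> ip (\<lambda>x. 0) f = 0"
  using scale_left[of f f 0] by simp

lemma sum_in: "(\<And>i. i < n \<Longrightarrow> u i \<in> S) \<Longrightarrow> (\<lambda>x. \<Sum>i<(n::nat). a i * u i x) \<in> S"
  proof (induction n)
  case (Suc n)
  then show ?case using add_in[OF Suc.IH scale_in[of "u n" "a n"]] by simp
qed (simp add: zero_in)

lemma sum_left:
  "(\<And>i. i < n \<Longrightarrow> u i \<in> S) \<Longrightarrow> g \<in> S \<Longrightarrow>
     ip (\<lambda>x. \<Sum>i<(n::nat). a i * u i x) g = (\<Sum>i<n. a i * ip (u i) g)"
  by (induction n) (auto simp: zero_left add_left scale_left sum_in scale_in)

lemmas in_intros = zero_in add_in scale_in diff_in sum_in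
lemmas ip_simps = add_left add_right diff_left diff_right scale_left scale_right in_intros

lemma cauchy_schwarz_sq:
  assumes "f \<in> S" "g \<in> S" shows "(ip f g)\<^sup>2 \<le> ip f f * ip g g"
proof (rule quadratic_nonneg_imp_discriminant)
  fix t :: real
  have "0 \<le> ip (\<lambda>x. f x - t * g x) (\<lambda>x. f x - t * g x)" using assms by (intro nonneg in_intros)
  also have "\<dots> = ip f f - 2 * t * ip f g + t\<^sup>2 * ip g g"
    using assms commute[of g f] by (simp add: ip_simps algebra_simps power2_eq_square)
  finally show "ip f f - 2 * t * ip f g + t\<^sup>2 * ip g g \<ge> 0" .
qed (use assms nonneg in auto)

lemma norm_sq: "f \<in> S \<Longrightarrow> (F_norm ip f)\<^sup>2 = ip f f"
  by (simp add: F_norm_def nonneg)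

lemma norm_nonneg: "f \<in> S \<Longrightarrow> 0 \<le> F_norm ip f"
  by (simp add: F_norm_def nonneg)

lemma norm_scale: "f \<in> S \<Longrightarrow> F_norm ip (\<lambda>x. c * f x) = \<bar>c\<bar> * F_norm ip f"
proof -
  assume f: "f \<in> S"
  then have "ip (\<lambda>x. c * f x) (\<lambda>x. c * f x) = c\<^sup>2 * ip f f"
    by (simp add: ip_simps power2_eq_square)
  then show ?thesis by (simp add: F_norm_def real_sqrt_mult)
qed

lemma cauchy_schwarz:
  assumes "f \<in> S" "g \<in> S" shows "\<bar>ip f g\<bar> \<le> F_norm ip f * F_norm ip g"
proof -
  have "\<bar>ip f g\<bar> \<le> sqrt (ip f f * ip g g)"
    using cauchy_schwarz_sq[OF assms] by (intro real_le_rsqrt) simp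
  then show ?thesis by (simp add: F_norm_def real_sqrt_mult)
qed

lemma norm_triangle:
  assumes "f \<in> S" "g \<in> S" shows "F_norm ip (\<lambda>x. f x + g x) \<le> F_norm ip f + F_norm ip g"
proof (rule power2_le_imp_le)
  have "(F_norm ip (\<lambda>x. f x + g x))\<^sup>2 = ip f f + 2 * ip f g + ip g g"
    using assms commute[of g f] by (simp add: norm_sq ip_simps)
  also have "\<dots> \<le> (F_norm ip f)\<^sup>2 + 2 * (F_norm ip f * F_norm ip g) + (F_norm ip g)\<^sup>2"
    using cauchy_schwarz[OF assms] assms by (simp add: norm_sq)
  also have "\<dots> = (F_norm ip f + F_norm ip g)\<^sup>2" by (simp add: power2_sum)
  finally show "(F_norm ip (\<lambda>x. f x + g x))\<^sup>2 \<le> (F_norm ip f + F_norm ip g)\<^sup>2" .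
qed (use assms norm_nonneg in auto)

lemma orthonormalD:
  assumes "orthonormal S ip r b"
  shows "i < r \<Longrightarrow> b i \<in> S" and "i < r \<Longrightarrow> j < r \<Longrightarrow> ip (b i) (b j) = (if i = j then 1 else 0)"
  using assms by (auto simp: orthonormal_def)

lemma ip_combination:
  assumes "orthonormal S ip r b" "j < r"
  shows "ip (\<lambda>x. \<Sum>i<r. a i * b i x) (b j) = a j"
proof -
  have "ip (\<lambda>x. \<Sum>i<r. a i * b i x) (b j) = (\<Sum>i<r. a i * (if i = j then 1 else 0))"
    using assms by (subst sum_left) (auto simp: orthonormal_def)
  also have "\<dots> = a j" using assms by (simp add: if_distrib[of "\<lambda>z. _ * z"] cong: if_cong)
  finally show ?thesis .
qed

lemma residual_in: "orthonormal S ip r b \<Longrightarrow> f \<in> S \<Longrightarrow> residual ip r b f \<in> S"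
  unfolding residual_def by (intro diff_in sum_in) (auto simp: orthonormal_def)

lemma residual_orthogonal:
  assumes "orthonormal S ip r b" "f \<in> S" "j < r"
  shows "ip (residual ip r b f) (b j) = 0"
  unfolding residual_def using assms ip_combination[OF assms(1,3)]
  by (subst diff_left) (auto simp: orthonormalD intro!: sum_in)

lemma ip_combination_orthogonal:
  assumes "orthonormal S ip r b" "h \<in> S" "\<And>j. j < r \<Longrightarrow> ip h (b j) = 0"
  shows "ip (\<lambda>x. \<Sum>i<r. a i * b i x) h = 0"
  using assms by (subst sum_left) (auto simp: orthonormalD commute[of _ h])

text \<open>
  Pythagoras for a combination of the \<open>b\<^sub>i\<close> and a function orthogonal to all of them.
\<close>
lemma norm_sq_orthogonal_add:
  assumes b: "orthonormal S ip r b" and h: "h \<in> S" "\<And>j. j < r \<Longrightarrow> ip h (b j) = 0"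
  shows "ip (\<lambda>x. h x + (\<Sum>i<r. a i * b i x)) (\<lambda>x. h x + (\<Sum>i<r. a i * b i x))
    = ip h h + (\<Sum>i<r. (a i)\<^sup>2)"
proof -
  let ?p = "\<lambda>x. \<Sum>i<r. a i * b i x"
  have p: "?p \<in> S" using b by (intro sum_in) (auto simp: orthonormalD)
  have "ip ?p ?p = (\<Sum>i<r. a i * ip (b i) ?p)"
    using b p by (subst sum_left) (auto simp: orthonormalD)
  also have "\<dots> = (\<Sum>i<r. (a i)\<^sup>2)"
    using b p ip_combination[OF b, of _ a]
    by (intro sum.cong) (auto simp: orthonormalD commute[of _ ?p] power2_eq_square)
  finally have "ip ?p ?p = (\<Sum>i<r. (a i)\<^sup>2)" .
  moreover have "ip ?p h = 0" using b h by (rule ip_combination_orthogonal)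
  ultimately show ?thesis using p h by (simp add: add_left add_right add_in commute[of h ?p])
qed

lemma ip_residual_le:
  assumes "orthonormal S ip r b" "f \<in> S"
  shows "ip (residual ip r b f) (residual ip r b f) \<le> ip f f"
proof -
  have "f = (\<lambda>x. residual ip r b f x + (\<Sum>i<r. ip f (b i) * b i x))"
    by (auto simp: residual_def)
  then have "ip f f = ip (residual ip r b f) (residual ip r b f) + (\<Sum>i<r. (ip f (b i))\<^sup>2)"
    using norm_sq_orthogonal_add[OF assms(1) residual_in[OF assms] residual_orthogonal[OF assms],
        where a="\<lambda>i. ip f (b i)"] by simp
  then show ?thesis by (simp add: sum_nonneg)
qed

lemma norm_residual_le:
  assumes "orthonormal S ip r b" "f \<in> S" shows "F_norm ip (residual ip r b f) \<le> F_norm ip f"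
  using ip_residual_le[OF assms] by (simp add: F_norm_def)

lemma orthonormal_extend:
  assumes b: "orthonormal S ip r b" and h: "h \<in> S" "\<And>j. j < r \<Longrightarrow> ip h (b j) = 0" "ip h h \<noteq> 0"
  shows "orthonormal S ip (Suc r) (b(r := \<lambda>x. inverse (F_norm ip h) * h x))"
proof -
  have n: "F_norm ip h \<noteq> 0" using norm_sq[OF h(1)] h(3) by auto
  have hh: "ip h h = F_norm ip h * F_norm ip h" using norm_sq[OF h(1)] by (simp add: power2_eq_square)
  have "inverse (F_norm ip h) * (inverse (F_norm ip h) * (F_norm ip h * F_norm ip h)) = 1"
    using n by (simp add: field_simps)
  moreover have "ip (b j) h = 0" if "j < r" for j
    using h that b commute[of "b j" h] by (auto simp: orthonormalD)
  ultimately show ?thesis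
    using b h hh unfolding orthonormal_def
    by (auto simp: less_Suc_eq scale_left scale_right scale_in)
qed

text \<open>
  Vectors that depend on their predecessors up to distance zero are skipped, hence \<open>r \<le> n\<close> instead
  of equality.
\<close>
lemma gram_schmidt:
  assumes "\<And>i. i < n \<Longrightarrow> u i \<in> S"
  shows "\<exists>r b. r \<le> n \<and> orthonormal S ip r b \<and> (\<forall>i<n. F_norm ip (residual ip r b (u i)) = 0)"
  using assms
proof (induction n)
  case 0
  show ?case by (intro exI[of _ 0]) (auto simp: orthonormal_def)
next
  case (Suc n)
  then obtain r b where r: "r \<le> n" and b: "orthonormal S ip r b"
    and res: "\<forall>i<n. F_norm ip (residual ip r b (u i)) = 0" by auto
  have un: "u n \<in> S" using Suc.prems by simp
  define h where "h = residual ip r b (u n)"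
  have h: "h \<in> S" "\<And>j. j < r \<Longrightarrow> ip h (b j) = 0"
    unfolding h_def using residual_in[OF b un] residual_orthogonal[OF b un] by auto
  show ?case
  proof (cases "ip h h = 0")
    case True
    then show ?thesis using r b res
      by (intro exI[of _ r] exI[of _ b]) (auto simp: less_Suc_eq h_def F_norm_def)
  next
    case False
    define b' where "b' = b(r := \<lambda>x. inverse (F_norm ip h) * h x)"
    have b': "orthonormal S ip (Suc r) b'" unfolding b'_def by (rule orthonormal_extend[OF b h False])
    have n: "F_norm ip h \<noteq> 0" using norm_sq[OF h(1)] False by auto
    have b'r: "b' r \<in> S" using b' by (simp add: orthonormalD)
    have split: "residual ip (Suc r) b' f = (\<lambda>x. residual ip r b f x - ip f (b' r) * b' r x)" for f
    proof -
      have "(\<Sum>i<r. ip f (b' i) * b' i x) = (\<Sum>i<r. ip f (b i) * b i x)" for x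
        by (intro sum.cong) (auto simp: b'_def)
      then show ?thesis by (auto simp: residual_def)
    qed
    have proj: "ip f (b' r) = ip (residual ip r b f) (b' r)" if f: "f \<in> S" for f
    proof -
      have "ip f (b' r) - ip (\<lambda>x. \<Sum>i<r. ip f (b i) * b i x) (b' r) = ip (residual ip r b f) (b' r)"
        unfolding residual_def
        by (rule diff_left[symmetric]) (use f b b'r in \<open>auto intro!: sum_in simp: orthonormalD\<close>)
      moreover have "ip (\<lambda>x. \<Sum>i<r. ip f (b i) * b i x) (b' r) = 0"
      proof (rule ip_combination_orthogonal[OF b b'r])
        fix j assume "j < r"
        then show "ip (b' r) (b j) = 0" using orthonormalD(2)[OF b', of r j] by (simp add: b'_def)
      qed
      ultimately show ?thesis by simp
    qed
    have "F_norm ip (residual ip (Suc r) b' (u i)) = 0" if "i < Suc n" for i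
    proof (cases "i = n")
      case True
      have hh: "ip h h = F_norm ip h * F_norm ip h"
        using norm_sq[OF h(1)] by (simp add: power2_eq_square)
      have "ip h (b' r) = F_norm ip h"
        using h n hh by (simp add: b'_def scale_right)
      then have "residual ip (Suc r) b' (u n) = (\<lambda>x. 0)"
        using n by (simp add: split proj[OF un]) (simp add: b'_def h_def[symmetric] field_simps)
      then show ?thesis using True zero_left[OF zero_in] by (simp add: F_norm_def)
    next
      case False
      then have ui: "u i \<in> S" "F_norm ip (residual ip r b (u i)) = 0" using that Suc.prems res by auto
      have "\<bar>ip (residual ip r b (u i)) (b' r)\<bar> \<le> 0"
        using cauchy_schwarz[OF residual_in[OF b ui(1)] b'r] ui(2) by simp
      then show ?thesis by (simp add: split proj[OF ui(1)] ui(2))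
    qed
    then show ?thesis using r b' by (intro exI[of _ "Suc r"] exI[of _ b']) auto
  qed
qed

text \<open>
  The classical argument: by the parallelogram law a sequence in \<open>K\<close> that minimizes the distance to
  \<open>h\<close> is Cauchy, and its limit is the projection onto the closure of \<open>K\<close>.  Since \<open>K\<close> itself need not be
  closed (it will be the kernel of possibly discontinuous functionals), the projection \<open>p\<close> is
  described by an approximating sequence from \<open>K\<close>.
\<close>
lemma orthogonal_projection:
  assumes K: "K \<subseteq> S" "(\<lambda>x. 0) \<in> K" "\<And>f g. f \<in> K \<Longrightarrow> g \<in> K \<Longrightarrow> (\<lambda>x. f x + g x) \<in> K"
      "\<And>f c. f \<in> K \<Longrightarrow> (\<lambda>x. c * f x) \<in> K"
    and complete: "\<And>X. (\<And>i. X i \<in> S) \<Longrightarrow>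
          (\<And>e. e > 0 \<Longrightarrow> \<exists>N. \<forall>i\<ge>N. \<forall>j\<ge>N. F_norm ip (\<lambda>x. X i x - X j x) < e) \<Longrightarrow>
          \<exists>f\<in>S. (\<lambda>i. F_norm ip (\<lambda>x. X i x - f x)) \<longlonglongrightarrow> 0"
    and h: "h \<in> S"
  shows "\<exists>p\<in>S. \<exists>k. (\<forall>i. k i \<in> K) \<and> (\<lambda>i. F_norm ip (\<lambda>x. k i x - p x)) \<longlonglongrightarrow> 0
           \<and> (\<forall>v\<in>K. ip (\<lambda>x. h x - p x) v = 0)"
proof -
  define E where "E k = ip (\<lambda>x. h x - k x) (\<lambda>x. h x - k x)" for k
  define d where "d = (INF k\<in>K. E k)"
  have E0: "E k \<ge> 0" if "k \<in> K" for k
    unfolding E_def using that K h by (intro nonneg diff_in) auto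
  have bdd: "bdd_below (E ` K)" using E0 by (intro bdd_belowI[of _ 0]) auto
  have dE: "d \<le> E k" if "k \<in> K" for k unfolding d_def using that bdd by (rule cINF_lower[rotated])
  have "\<exists>k\<in>K. E k < d + 1 / (real i + 1)" for i :: nat
  proof -
    have "d < d + 1 / (real i + 1)" by simp
    then show ?thesis unfolding d_def using cINF_less_iff[OF _ bdd] K(2) by blast
  qed
  then obtain k where k: "\<And>i. k i \<in> K" "\<And>i. E (k i) < d + 1 / (real i + 1)" by metis
  have kS: "k i \<in> S" for i using k K by auto
  have close: "(F_norm ip (\<lambda>x. k i x - k j x))\<^sup>2 \<le> 2 / (real i + 1) + 2 / (real j + 1)" for i j
  proof -
    define c :: real where "c = 1 / 2"
    define v where "v = (\<lambda>x. c * (k i x + k j x))"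
    have v: "v \<in> K" unfolding v_def using k K by auto
    have "(F_norm ip (\<lambda>x. k i x - k j x))\<^sup>2 = 2 * E (k i) + 2 * E (k j) - 4 * E v"
      unfolding E_def v_def using kS h commute[of h "k i"] commute[of h "k j"] commute[of "k i" "k j"]
      by (simp add: norm_sq ip_simps) (simp add: c_def algebra_simps)
    then show ?thesis using dE[OF v] k(2)[of i] k(2)[of j] by simp
  qed
  have "\<exists>p\<in>S. (\<lambda>i. F_norm ip (\<lambda>x. k i x - p x)) \<longlonglongrightarrow> 0"
  proof (rule complete[OF kS])
    fix e :: real assume e: "e > 0"
    obtain N :: nat where N: "real N > 4 / e\<^sup>2" using reals_Archimedean2 by blast
    have "F_norm ip (\<lambda>x. k i x - k j x) < e" if "i \<ge> N" "j \<ge> N" for i j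
    proof -
      have "4 < e\<^sup>2 * real N" using N e by (simp add: divide_less_eq mult.commute)
      also have "\<dots> \<le> e\<^sup>2 * (real N + 1)" by (intro mult_left_mono) auto
      finally have "4 / (real N + 1) < e\<^sup>2" by (simp add: divide_less_eq)
      moreover have "2 / (real i + 1) \<le> 2 / (real N + 1)" "2 / (real j + 1) \<le> 2 / (real N + 1)"
        using that by (auto intro!: divide_left_mono)
      ultimately have "(F_norm ip (\<lambda>x. k i x - k j x))\<^sup>2 < e\<^sup>2" using close[of i j] by linarith
      then show ?thesis using e by (intro power_less_imp_less_base[of _ 2 e]) auto
    qed
    then show "\<exists>N. \<forall>i\<ge>N. \<forall>j\<ge>N. F_norm ip (\<lambda>x. k i x - k j x) < e" by blast
  qed
  then obtain p where p: "p \<in> S" and lim: "(\<lambda>i. F_norm ip (\<lambda>x. k i x - p x)) \<longlonglongrightarrow> 0" by blast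
  have "ip (\<lambda>x. h x - p x) v = 0" if v: "v \<in> K" for v
  proof -
    have vS: "v \<in> S" using v K by auto
    have bound: "(ip (\<lambda>x. h x - k i x) v)\<^sup>2 \<le> 1 / (real i + 1) * ip v v" for i
    proof (rule quadratic_nonneg_imp_discriminant)
      fix t :: real
      have "(\<lambda>x. k i x + t * v x) \<in> K" using k v K by auto
      then have "d \<le> E (\<lambda>x. k i x + t * v x)" by (rule dE)
      also have "\<dots> = E (k i) - 2 * t * ip (\<lambda>x. h x - k i x) v + t\<^sup>2 * ip v v"
        unfolding E_def using kS[of i] h vS commute[of h v] commute[of "k i" v] commute[of h "k i"]
        by (simp add: ip_simps power2_eq_square) (simp add: algebra_simps)
      finally show "1 / (real i + 1) - 2 * t * ip (\<lambda>x. h x - k i x) v + t\<^sup>2 * ip v v \<ge> 0"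
        using k(2)[of i] by linarith
    qed (use nonneg vS in auto)
    have "(\<lambda>i. ip (\<lambda>x. h x - k i x) v) \<longlonglongrightarrow> 0"
    proof -
      have "(\<lambda>i. 1 / (real i + 1) * ip v v) \<longlonglongrightarrow> 0"
        using tendsto_mult_right[OF LIMSEQ_inverse_real_of_nat, of "ip v v"]
        by (simp add: inverse_eq_divide add.commute)
      then have "(\<lambda>i. (ip (\<lambda>x. h x - k i x) v)\<^sup>2) \<longlonglongrightarrow> 0"
        by (rule Lim_null_comparison[rotated]) (use bound in \<open>simp only: real_norm_def abs_power2 eventually_sequentially, blast\<close>)
      then have "(\<lambda>i. sqrt ((ip (\<lambda>x. h x - k i x) v)\<^sup>2)) \<longlonglongrightarrow> sqrt 0" by (rule tendsto_real_sqrt)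
      then show ?thesis by (simp add: tendsto_rabs_zero_iff)
    qed
    moreover have "(\<lambda>i. ip (\<lambda>x. k i x - p x) v) \<longlonglongrightarrow> 0"
    proof (rule Lim_null_comparison)
      show "\<forall>\<^sub>F i in sequentially. norm (ip (\<lambda>x. k i x - p x) v)
          \<le> F_norm ip (\<lambda>x. k i x - p x) * F_norm ip v"
        using cauchy_schwarz[OF diff_in[OF kS p] vS] by simp
      show "(\<lambda>i. F_norm ip (\<lambda>x. k i x - p x) * F_norm ip v) \<longlonglongrightarrow> 0"
        using tendsto_mult_left_zero[OF lim] by simp
    qed
    ultimately have "(\<lambda>i. ip (\<lambda>x. h x - k i x) v + ip (\<lambda>x. k i x - p x) v) \<longlonglongrightarrow> 0 + 0"
      by (rule tendsto_add)
    moreover have "ip (\<lambda>x. h x - k i x) v + ip (\<lambda>x. k i x - p x) v = ip (\<lambda>x. h x - p x) v" for i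
      using kS[of i] h p vS by (simp add: ip_simps)
    ultimately show ?thesis by (simp add: LIMSEQ_const_iff)
  qed
  with p lim k(1) show ?thesis by blast
qed

end

context function_inner_space begin

lemma linear_sum:
  assumes L: "L \<in> Lambda_all S" and u: "\<And>i. i < r \<Longrightarrow> u i \<in> S"
  shows "L (\<lambda>x. \<Sum>i<(r::nat). a i * u i x) = (\<Sum>i<r. a i * L (u i))"
  using u
proof (induction r)
  case 0
  have "L (\<lambda>x. c * f x) = c * L f" if "f \<in> S" for c f
    using L that by (simp add: Lambda_all_def)
  from this[OF zero_in, of 0] show ?case by simp
next
  case (Suc r)
  have "(\<lambda>x. \<Sum>i<r. a i * u i x) \<in> S" "(\<lambda>x. a r * u r x) \<in> S" "u r \<in> S"
    using Suc.prems by (auto intro!: sum_in scale_in)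
  then show ?case using Suc L by (simp add: Lambda_all_def)
qed

text \<open>
  More than \<open>m\<close> vectors would have a nontrivial combination that is annihilated by all \<open>L\<^sub>j\<close>; it would
  lie in the kernel and be orthogonal to the kernel at the same time.
\<close>
lemma orthonormal_perp_kernel_le:
  assumes u: "orthonormal S ip r u" and L: "\<And>j. j < m \<Longrightarrow> L j \<in> Lambda_all S"
    and perp: "\<And>i k. i < r \<Longrightarrow> k \<in> S \<Longrightarrow> (\<forall>j<m. L j k = 0) \<Longrightarrow> ip (u i) k = 0"
  shows "r \<le> m"
proof (rule ccontr)
  assume "\<not> r \<le> m"
  then obtain a where a: "\<exists>i\<in>{..<r}. a i \<noteq> 0" "\<forall>j<m. (\<Sum>i<r. a i * L j (u i)) = 0"
    using underdetermined_system[of "{..<r}" m "\<lambda>j i. L j (u i)"] by auto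
  define k where "k = (\<lambda>x. \<Sum>i<r. a i * u i x)"
  have k: "k \<in> S" unfolding k_def using u by (intro sum_in) (auto simp: orthonormalD)
  have "\<forall>j<m. L j k = 0"
    using a(2) L u by (auto simp: k_def linear_sum orthonormalD)
  then have "ip (u i) k = 0" if "i < r" for i using perp that k by blast
  moreover have "ip k (u i) = a i" if "i < r" for i
    unfolding k_def using ip_combination[OF u that] .
  ultimately show False using a(1) u k commute by (force simp: orthonormalD)
qed

text \<open>
  The \<open>u\<^sub>i\<close> form a maximal orthonormal system orthogonal to the kernel.  If the remainder of some \<open>f\<close> were
  not in the closure of the kernel, then its component orthogonal to the kernel would extend the system.
\<close>
lemma kernel_complement:
  assumes complete: "\<And>X. (\<And>i. X i \<in> S) \<Longrightarrow>
          (\<And>e. e > 0 \<Longrightarrow> \<exists>N. \<forall>i\<ge>N. \<forall>j\<ge>N. F_norm ip (\<lambda>x. X i x - X j x) < e) \<Longrightarrow>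
          \<exists>f\<in>S. (\<lambda>i. F_norm ip (\<lambda>x. X i x - f x)) \<longlonglongrightarrow> 0"
    and L: "\<And>j. j < m \<Longrightarrow> L j \<in> Lambda_all S"
  shows "\<exists>r u. r \<le> m \<and> orthonormal S ip r u \<and>
     (\<forall>f\<in>S. \<forall>e>0. \<exists>k\<in>S. (\<forall>j<m. L j k = 0) \<and> F_norm ip (\<lambda>x. residual ip r u f x - k x) < e)"
proof -
  define K where "K = {k\<in>S. \<forall>j<m. L j k = 0}"
  define R where "R r \<longleftrightarrow> (\<exists>u. orthonormal S ip r u \<and> (\<forall>i<r. \<forall>k\<in>K. ip (u i) k = 0))" for r
  have le: "r \<le> m" if "R r" for r
  proof -
    from that obtain u where u: "orthonormal S ip r u" "\<And>i k. i < r \<Longrightarrow> k \<in> K \<Longrightarrow> ip (u i) k = 0"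
      by (auto simp: R_def)
    show ?thesis
      by (rule orthonormal_perp_kernel_le[OF u(1) L]) (auto intro!: u(2) simp: K_def)
  qed
  have "R 0" by (simp add: R_def orthonormal_def)
  then obtain r where "R r" and r_max: "\<And>r'. R r' \<Longrightarrow> r' \<le> r"
    using Nat.ex_has_greatest_nat[of R 0 m] le by auto
  then obtain u where u: "orthonormal S ip r u" and perp: "\<And>i k. i < r \<Longrightarrow> k \<in> K \<Longrightarrow> ip (u i) k = 0"
    by (auto simp: R_def)
  have L0: "L j (\<lambda>x. 0) = 0" if "j < m" for j
    using linear_sum[OF L[OF that], of 0] by simp
  have Ladd: "L j (\<lambda>x. f x + g x) = L j f + L j g" if "j < m" "f \<in> S" "g \<in> S" for j f g
    using L[OF that(1)] that by (simp add: Lambda_all_def)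
  have Lscale: "L j (\<lambda>x. c * f x) = c * L j f" if "j < m" "f \<in> S" for j f c
    using L[OF that(1)] that by (simp add: Lambda_all_def)
  have K: "K \<subseteq> S" "(\<lambda>x. 0) \<in> K" "\<And>f g. f \<in> K \<Longrightarrow> g \<in> K \<Longrightarrow> (\<lambda>x. f x + g x) \<in> K"
      "\<And>f c. f \<in> K \<Longrightarrow> (\<lambda>x. c * f x) \<in> K"
    by (auto simp: K_def zero_in add_in scale_in L0 Ladd Lscale)
  have "\<exists>k\<in>K. F_norm ip (\<lambda>x. residual ip r u f x - k x) < e" if f: "f \<in> S" and e: "e > 0" for f e
  proof -
    define h where "h = residual ip r u f"
    have h: "h \<in> S" "\<And>j. j < r \<Longrightarrow> ip h (u j) = 0"
      unfolding h_def using residual_in[OF u f] residual_orthogonal[OF u f] by auto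
    have "\<exists>p\<in>S. \<exists>k. (\<forall>i. k i \<in> K) \<and> (\<lambda>i. F_norm ip (\<lambda>x. k i x - p x)) \<longlonglongrightarrow> 0
        \<and> (\<forall>v\<in>K. ip (\<lambda>x. h x - p x) v = 0)"
      by (rule orthogonal_projection[OF K(1,2) _ _ _ h(1)])
        (blast intro: K(3), blast intro: K(4), rule complete)
    then obtain p k where p: "p \<in> S" and k: "\<And>i. k i \<in> K"
      and lim: "(\<lambda>i. F_norm ip (\<lambda>x. k i x - p x)) \<longlonglongrightarrow> 0"
      and hp: "\<And>v. v \<in> K \<Longrightarrow> ip (\<lambda>x. h x - p x) v = 0"
      by blast
    have kS: "k i \<in> S" for i using k K by auto
    define w where "w = (\<lambda>x. h x - p x)"
    have w: "w \<in> S" unfolding w_def using h p by (intro diff_in)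
    have wu: "ip w (u j) = 0" if j: "j < r" for j
    proof -
      have uj: "u j \<in> S" using u j by (simp add: orthonormalD)
      have "\<bar>ip p (u j)\<bar> \<le> F_norm ip (\<lambda>x. k i x - p x) * F_norm ip (u j)" for i
        using cauchy_schwarz[OF diff_in[OF kS p] uj, of i] perp[OF j k, of i] uj p kS[of i]
          commute[OF uj kS, of i] by (simp add: diff_left)
      then have "\<bar>ip p (u j)\<bar> \<le> 0"
        using tendsto_mult_left_zero[OF lim, of "F_norm ip (u j)"]
        by (intro LIMSEQ_le_const) auto
      then show ?thesis using h p uj j by (simp add: w_def diff_left)
    qed
    have "ip w w = 0"
    proof (rule ccontr)
      assume ne: "ip w w \<noteq> 0"
      let ?u = "u(r := \<lambda>x. inverse (F_norm ip w) * w x)"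
      have "orthonormal S ip (Suc r) ?u" by (rule orthonormal_extend[OF u w wu ne])
      moreover have "ip (?u i) v = 0" if "i < Suc r" "v \<in> K" for i v
        using that perp hp[OF that(2), folded w_def] w K(1)
        by (auto simp: less_Suc_eq scale_left subset_iff)
      ultimately have "R (Suc r)" unfolding R_def by blast
      then show False using r_max[of "Suc r"] by simp
    qed
    then have w0: "F_norm ip w = 0" by (simp add: F_norm_def)
    have "\<forall>\<^sub>F i in sequentially. F_norm ip (\<lambda>x. k i x - p x) < e"
      using order_tendstoD(2)[OF lim e] .
    then obtain i where i: "F_norm ip (\<lambda>x. k i x - p x) < e" by (auto simp: eventually_sequentially)
    have "F_norm ip (\<lambda>x. h x - k i x) = F_norm ip (\<lambda>x. w x + (-1) * (k i x - p x))"
      by (simp add: w_def algebra_simps)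
    also have "\<dots> \<le> F_norm ip w + F_norm ip (\<lambda>x. (-1) * (k i x - p x))"
      using w diff_in[OF kS p] by (intro norm_triangle scale_in)
    also have "\<dots> = F_norm ip (\<lambda>x. k i x - p x)"
      using norm_scale[OF diff_in[OF kS p], of "-1" i] w0 by simp
    finally show ?thesis using i k[of i] unfolding h_def[symmetric] by (intro bexI[of _ "k i"]) auto
  qed
  then show ?thesis using u le[OF \<open>R r\<close>] unfolding K_def by blast
qed

text \<open>
  The residual is linear and vanishes on the \<open>u\<^sub>i\<close>, so it sees only the part \<open>h\<close>.
\<close>
lemma norm_residual_le_of_residual:
  assumes b: "orthonormal S ip r b" and u: "\<And>i. i < n \<Longrightarrow> u i \<in> S"
    and h: "h \<in> S" and z: "\<And>i. i < (n::nat) \<Longrightarrow> F_norm ip (residual ip r b (u i)) = 0"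
  shows "F_norm ip (residual ip r b (\<lambda>x. h x + (\<Sum>i<n. a i * u i x))) \<le> F_norm ip h"
  using u z
proof (induction n)
  case 0
  then show ?case using norm_residual_le[OF b h] by simp
next
  case (Suc n)
  define f where "f = (\<lambda>x. h x + (\<Sum>i<n. a i * u i x))"
  have f: "f \<in> S" unfolding f_def using Suc.prems h by (intro add_in sum_in) auto
  have un: "u n \<in> S" using Suc.prems by simp
  have "residual ip r b (\<lambda>x. f x + a n * u n x) x = residual ip r b f x + a n * residual ip r b (u n) x" for x
  proof -
    have "(\<Sum>i<r. ip (\<lambda>x. f x + a n * u n x) (b i) * b i x)
        = (\<Sum>i<r. ip f (b i) * b i x + a n * (ip (u n) (b i) * b i x))"
      using f un b by (intro sum.cong) (auto simp: add_left scale_left scale_in orthonormalD algebra_simps)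
    also have "\<dots> = (\<Sum>i<r. ip f (b i) * b i x) + a n * (\<Sum>i<r. ip (u n) (b i) * b i x)"
      by (simp add: sum.distrib sum_distrib_left)
    finally show ?thesis by (simp add: residual_def algebra_simps)
  qed
  then have "F_norm ip (residual ip r b (\<lambda>x. f x + a n * u n x))
      = F_norm ip (\<lambda>x. residual ip r b f x + a n * residual ip r b (u n) x)" by presburger
  also have "\<dots> \<le> F_norm ip (residual ip r b f) + F_norm ip (\<lambda>x. a n * residual ip r b (u n) x)"
    using b f un by (intro norm_triangle scale_in residual_in)
  also have "\<dots> = F_norm ip (residual ip r b f)"
    using norm_scale[OF residual_in[OF b un]] Suc.prems by simp
  also have "\<dots> \<le> F_norm ip h" unfolding f_def using Suc by auto
  finally show ?case by (simp add: f_def add.assoc)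
qed

end

section \<open>A good subspace from an arbitrary algorithm\<close>

lemma l2_norm_eq_F_norm: "l2_norm \<mu> = F_norm (l2_inner \<mu>)"
  by (auto simp: l2_norm_def F_norm_def)

lemma L2_mult_integrable:
  assumes "f \<in> L2 \<mu>" "g \<in> L2 \<mu>" shows "integrable \<mu> (\<lambda>x. f x * g x)"
proof (rule Bochner_Integration.integrable_bound)
  show "integrable \<mu> (\<lambda>x. (f x)\<^sup>2 + (g x)\<^sup>2)" using assms by (auto simp: L2_def)
  show "(\<lambda>x. f x * g x) \<in> borel_measurable \<mu>" using assms by (auto simp: L2_def)
  have "\<bar>a * b\<bar> \<le> a\<^sup>2 + b\<^sup>2" for a b :: real
    using sum_squares_bound[of a b] sum_squares_bound[of "- a" b] zero_le_power2[of a] zero_le_power2[of b]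
    by (simp add: abs_le_iff)
  then show "AE x in \<mu>. norm (f x * g x) \<le> norm ((f x)\<^sup>2 + (g x)\<^sup>2)"
    by (auto simp: abs_of_nonneg)
qed

lemma L2_inner_space: "function_inner_space (L2 \<mu>) (l2_inner \<mu>)"
proof
  show "(\<lambda>x. 0) \<in> L2 \<mu>" by (simp add: L2_def)
next
  fix f g assume fg: "f \<in> L2 \<mu>" "g \<in> L2 \<mu>"
  have "integrable \<mu> (\<lambda>x. (f x)\<^sup>2 + 2 * (f x * g x) + (g x)\<^sup>2)"
    using fg L2_mult_integrable[OF fg] by (auto simp: L2_def)
  then show "(\<lambda>x. f x + g x) \<in> L2 \<mu>"
    using fg by (auto simp: L2_def power2_sum algebra_simps)
  show "l2_inner \<mu> f g = l2_inner \<mu> g f" by (simp add: l2_inner_def mult.commute)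
  show "l2_inner \<mu> (\<lambda>x. c * f x) g = c * l2_inner \<mu> f g" for c
    by (simp add: l2_inner_def mult.assoc)
next
  fix f c assume "f \<in> L2 \<mu>"
  then show "(\<lambda>x. c * f x) \<in> L2 \<mu>" by (auto simp: L2_def power_mult_distrib)
next
  fix f g h assume "f \<in> L2 \<mu>" "g \<in> L2 \<mu>" "h \<in> L2 \<mu>"
  then show "l2_inner \<mu> (\<lambda>x. f x + g x) h = l2_inner \<mu> f h + l2_inner \<mu> g h"
    by (simp add: l2_inner_def distrib_right L2_mult_integrable)
next
  fix f show "0 \<le> l2_inner \<mu> f f" by (simp add: l2_inner_def)
qed

context approximation_setting begin

abbreviation "\<mu> \<equiv> weighted_measure D \<rho>"

lemma F_inner_space: "function_inner_space F ip"
  by unfold_locales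
    (auto simp: F_zero F_add F_scale ip_add_left ip_scale_left ip_nonneg intro: ip_commute)

text \<open>
  An unbounded embedding would admit a bounded sequence whose \<open>L\<^sub>2\<close> norms tend to infinity, and no
  subsequence of it could converge in \<open>L\<^sub>2\<close>.
\<close>
lemma embedding_bounded: "\<exists>C\<ge>0. \<forall>f\<in>F. l2_norm \<mu> f \<le> C * F_norm ip f"
proof (rule ccontr)
  interpret F: function_inner_space F ip by (rule F_inner_space)
  interpret G: function_inner_space "L2 \<mu>" "l2_inner \<mu>" by (rule L2_inner_space)
  assume "\<not> ?thesis"
  then have "\<forall>i::nat. \<exists>f\<in>F. l2_norm \<mu> f > real i * F_norm ip f" by (metis not_le of_nat_0_le_iff)
  then obtain f where f: "\<And>i. f i \<in> F" "\<And>i::nat. l2_norm \<mu> (f i) > real i * F_norm ip (f i)" by metis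
  have pos: "F_norm ip (f i) > 0" for i
  proof (rule ccontr)
    assume "\<not> ?thesis"
    then have "ip (f i) (f i) = 0" using F.norm_nonneg[OF f(1)[of i]] F.norm_sq[OF f(1)[of i]] by auto
    then have ae: "AE x in \<mu>. f i x = 0" using ip_eq_0_iff[OF f(1)] by simp
    have "l2_inner \<mu> (f i) (f i) = 0"
      unfolding l2_inner_def by (rule integral_eq_zero_AE) (use ae in auto)
    then have "l2_norm \<mu> (f i) = 0" by (simp add: l2_norm_def)
    moreover have "real i * F_norm ip (f i) \<ge> 0" using F.norm_nonneg[OF f(1)[of i]] by simp
    ultimately show False using f(2)[of i] by simp
  qed
  define X where "X i = (\<lambda>x. inverse (F_norm ip (f i)) * f i x)" for i
  have X: "X i \<in> F" for i unfolding X_def using f by (intro F_scale)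
  have XG: "X i \<in> L2 \<mu>" for i using X F_subset by auto
  have nX: "F_norm ip (X i) \<le> 1" for i
    unfolding X_def using pos[of i] by (subst F.norm_scale[OF f(1)]) (simp add: field_simps)
  have big: "l2_norm \<mu> (X i) \<ge> real i" for i
  proof -
    have "l2_norm \<mu> (X i) = inverse (F_norm ip (f i)) * l2_norm \<mu> (f i)"
      unfolding X_def l2_norm_eq_F_norm using f(1) F_subset pos[of i] by (subst G.norm_scale) auto
    then have "l2_norm \<mu> (X i) * F_norm ip (f i) = l2_norm \<mu> (f i)"
      using pos[of i] by (simp add: field_simps)
    with f(2)[of i] have "real i * F_norm ip (f i) < l2_norm \<mu> (X i) * F_norm ip (f i)"
      by (simp only:)
    then show ?thesis using pos[of i] by (simp add: mult_less_cancel_right_pos)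
  qed
  from F_compact[of X 1, OF X nX] obtain r g where r: "strict_mono r" and g: "g \<in> L2 \<mu>"
    and lim: "(\<lambda>i. l2_norm \<mu> (\<lambda>x. X (r i) x - g x)) \<longlonglongrightarrow> 0"
    by (elim exE conjE) (rule that)
  have "\<forall>\<^sub>F i in sequentially. l2_norm \<mu> (\<lambda>x. X (r i) x - g x) < 1"
    using order_tendstoD(2)[OF lim] by simp
  moreover have "\<forall>\<^sub>F i in sequentially. real i > 1 + l2_norm \<mu> g"
    using filterlim_real_sequentially by (simp add: filterlim_at_top_dense)
  ultimately have "\<forall>\<^sub>F i in sequentially. False"
  proof eventually_elim
    case (elim i)
    have "real i \<le> real (r i)" using seq_suble[OF r] by simp
    also have "\<dots> \<le> l2_norm \<mu> (X (r i))" by (rule big)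
    also have "\<dots> = l2_norm \<mu> (\<lambda>x. (X (r i) x - g x) + g x)" by simp
    also have "\<dots> \<le> l2_norm \<mu> (\<lambda>x. X (r i) x - g x) + l2_norm \<mu> g"
      unfolding l2_norm_eq_F_norm using XG g by (intro G.norm_triangle G.diff_in)
    finally show False using elim by simp
  qed
  then show False by simp
qed

text \<open>
  For \<open>f\<close> in the kernel, \<open>f\<close> and \<open>-f\<close> lead to the same output \<open>g\<close>; by the parallelogram law the larger
  of the two errors is at least the norm of \<open>f\<close>.
\<close>
lemma kernel_norm_le:
  assumes L: "\<And>j. j < m \<Longrightarrow> L j \<in> Lambda_all F"
    and \<phi>: "\<phi> \<in> (\<Pi>\<^sub>M j\<in>{..<m}. borel) \<rightarrow>\<^sub>M L2_borel \<mu>"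
    and err: "wor_error \<mu> F ip (\<lambda>f. \<phi> (\<lambda>j\<in>{..<m}. L j f)) \<le> ennreal s" and s: "s \<ge> 0"
    and k: "k \<in> F" "\<And>j. j < m \<Longrightarrow> L j k = 0"
  shows "l2_norm \<mu> k \<le> s * F_norm ip k"
proof -
  interpret F: function_inner_space F ip by (rule F_inner_space)
  interpret G: function_inner_space "L2 \<mu>" "l2_inner \<mu>" by (rule L2_inner_space)
  define g where "g = \<phi> (\<lambda>j\<in>{..<m}. 0)"
  have Lscale: "L j (\<lambda>x. c * f x) = c * L j f" if "j < m" "f \<in> F" for j c f
    using L[OF that(1)] that(2) by (simp add: Lambda_all_def)
  have "space (L2_borel \<mu>) = L2 \<mu>" unfolding L2_borel_def by (rule space_measure_of) auto
  then have g: "g \<in> L2 \<mu>"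
    using measurable_space[OF \<phi>, of "\<lambda>j\<in>{..<m}. 0"] by (simp add: g_def space_PiM)
  have ball: "l2_norm \<mu> f \<le> s" if f: "f \<in> F" "F_norm ip f \<le> 1" "\<And>j. j < m \<Longrightarrow> L j f = 0" for f
  proof -
    define f' where "f' = (\<lambda>x. (-1) * f x)"
    have fG: "f \<in> L2 \<mu>" using f F_subset by auto
    have f': "f' \<in> F" "F_norm ip f' \<le> 1" "\<And>j. j < m \<Longrightarrow> L j f' = 0"
      using f F.norm_scale[OF f(1), of "-1"] F_scale[OF f(1), of "-1"] Lscale[OF _ f(1), of _ "-1"]
      by (simp_all add: f'_def)
    have e: "l2_norm \<mu> (\<lambda>x. v x - g x) \<le> s"
      if v: "v \<in> F" "F_norm ip v \<le> 1" "\<And>j. j < m \<Longrightarrow> L j v = 0" for v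
    proof -
      have "\<phi> (\<lambda>j\<in>{..<m}. L j v) = g"
        unfolding g_def using v by (intro arg_cong[of _ _ \<phi>]) (auto simp: restrict_def)
      then have "ennreal (l2_norm \<mu> (\<lambda>x. v x - g x)) \<le> wor_error \<mu> F ip (\<lambda>f. \<phi> (\<lambda>j\<in>{..<m}. L j f))"
        unfolding wor_error_def using v by (intro SUP_upper2[of v]) (auto simp: unit_ball_def)
      also note err
      finally show ?thesis using s by simp
    qed
    have "(l2_norm \<mu> (\<lambda>x. f x - g x))\<^sup>2 + (l2_norm \<mu> (\<lambda>x. f' x - g x))\<^sup>2
        = 2 * (l2_norm \<mu> f)\<^sup>2 + 2 * (l2_norm \<mu> g)\<^sup>2"
      unfolding f'_def l2_norm_eq_F_norm
      by (simp only: G.norm_sq G.ip_simps fG g)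
    moreover have "(l2_norm \<mu> (\<lambda>x. f x - g x))\<^sup>2 \<le> s\<^sup>2" "(l2_norm \<mu> (\<lambda>x. f' x - g x))\<^sup>2 \<le> s\<^sup>2"
      using e[OF f] e[OF f'] fG g f'(1) F_subset
      by (auto intro!: power_mono simp: l2_norm_eq_F_norm G.norm_nonneg G.diff_in subset_iff)
    ultimately have "(l2_norm \<mu> f)\<^sup>2 \<le> s\<^sup>2" using zero_le_power2[of "l2_norm \<mu> g"] by linarith
    then show ?thesis using s by (rule power2_le_imp_le)
  qed
  show ?thesis
  proof (cases "F_norm ip k = 0")
    case True
    obtain C where "l2_norm \<mu> k \<le> C * F_norm ip k" using embedding_bounded k by blast
    then show ?thesis using True by simp
  next
    case False
    define c where "c = inverse (F_norm ip k)"
    have c: "c > 0" "c * F_norm ip k = 1" using False F.norm_nonneg[OF k(1)] by (auto simp: c_def)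
    have kG: "k \<in> L2 \<mu>" using k F_subset by auto
    have "l2_norm \<mu> (\<lambda>x. c * k x) \<le> s"
    proof (rule ball)
      show "(\<lambda>x. c * k x) \<in> F" using k by (intro F_scale)
      show "F_norm ip (\<lambda>x. c * k x) \<le> 1" using c by (simp add: F.norm_scale[OF k(1)])
      show "L j (\<lambda>x. c * k x) = 0" if "j < m" for j
        using L[OF that] k(1) k(2)[OF that] by (simp add: Lambda_all_def)
    qed
    then have "c * l2_norm \<mu> k \<le> s" using c by (simp add: l2_norm_eq_F_norm G.norm_scale[OF kG])
    then have "F_norm ip k * (c * l2_norm \<mu> k) \<le> F_norm ip k * s"
      using F.norm_nonneg[OF k(1)] by (rule mult_left_mono)
    then show ?thesis using c(2) by (simp add: mult_ac) (metis mult.assoc mult_1 mult.commute)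
  qed
qed

text \<open>
  The span of the \<open>b\<^sub>i\<close> is the \<open>F\<close>-orthogonal complement of the kernel of the functionals of an
  algorithm with error at most \<open>s\<close>.  Optimality of the \<open>L\<^sub>2\<close> projection is what lets the \<open>L\<^sub>2\<close> residual inherit the bound
  from the \<open>F\<close> residual.
\<close>
proposition best_subspace:
  assumes "e_wor \<mu> F ip m < ennreal s"
  shows "\<exists>r b. r \<le> m \<and> orthonormal (L2 \<mu>) (l2_inner \<mu>) r b \<and>
           (\<forall>f\<in>unit_ball F ip. l2_norm \<mu> (residual (l2_inner \<mu>) r b f) \<le> s)"
proof -
  interpret F: function_inner_space F ip by (rule F_inner_space)
  interpret G: function_inner_space "L2 \<mu>" "l2_inner \<mu>" by (rule L2_inner_space)
  have s: "s \<ge> 0" using assms ennreal_neg[of s] by (cases "s \<ge> 0") auto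
  from assms obtain \<phi> L where L: "\<And>j. j < m \<Longrightarrow> L j \<in> Lambda_all F"
    and \<phi>: "\<phi> \<in> (\<Pi>\<^sub>M j\<in>{..<m}. borel) \<rightarrow>\<^sub>M L2_borel \<mu>"
    and err: "wor_error \<mu> F ip (\<lambda>f. \<phi> (\<lambda>j\<in>{..<m}. L j f)) \<le> ennreal s"
    by (auto simp: e_wor_def INF_less_iff wor_algorithms_def intro: order_less_imp_le)
  have "\<exists>r u. r \<le> m \<and> orthonormal F ip r u \<and> (\<forall>f\<in>F. \<forall>e>0. \<exists>k\<in>F. (\<forall>j<m. L j k = 0) \<and>
      F_norm ip (\<lambda>x. residual ip r u f x - k x) < e)"
    by (rule F.kernel_complement) (rule F_complete, assumption+, rule L)
  then obtain r' u where r': "r' \<le> m" and u: "orthonormal F ip r' u"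
    and dense: "\<And>f e. f \<in> F \<Longrightarrow> e > 0 \<Longrightarrow>
        \<exists>k\<in>F. (\<forall>j<m. L j k = 0) \<and> F_norm ip (\<lambda>x. residual ip r' u f x - k x) < e"
    by blast
  obtain C where C: "C \<ge> 0" "\<And>f. f \<in> F \<Longrightarrow> l2_norm \<mu> f \<le> C * F_norm ip f"
    using embedding_bounded by blast
  have uF: "u i \<in> F" if "i < r'" for i using F.orthonormalD(1)[OF u that] .
  have uG: "u i \<in> L2 \<mu>" if "i < r'" for i using uF[OF that] F_subset by auto
  have "\<exists>r b. r \<le> r' \<and> orthonormal (L2 \<mu>) (l2_inner \<mu>) r b \<and>
      (\<forall>i<r'. F_norm (l2_inner \<mu>) (residual (l2_inner \<mu>) r b (u i)) = 0)"
    by (rule G.gram_schmidt) (rule uG)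
  then obtain r b where r: "r \<le> r'" and b: "orthonormal (L2 \<mu>) (l2_inner \<mu>) r b"
    and z: "\<And>i. i < r' \<Longrightarrow> F_norm (l2_inner \<mu>) (residual (l2_inner \<mu>) r b (u i)) = 0"
    by blast
  have "l2_norm \<mu> (residual (l2_inner \<mu>) r b f) \<le> s" if "f \<in> unit_ball F ip" for f
  proof -
    have f: "f \<in> F" "F_norm ip f \<le> 1" using that by (auto simp: unit_ball_def)
    define h where "h = residual ip r' u f"
    have h: "h \<in> F" "F_norm ip h \<le> 1"
      unfolding h_def using F.residual_in[OF u f(1)] F.norm_residual_le[OF u f(1)] f(2) by auto
    have hG: "h \<in> L2 \<mu>" using h F_subset by auto
    have f_eq: "f = (\<lambda>x. h x + (\<Sum>i<r'. ip f (u i) * u i x))" by (auto simp: h_def residual_def)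
    have "F_norm (l2_inner \<mu>) (residual (l2_inner \<mu>) r b f) \<le> F_norm (l2_inner \<mu>) h"
      by (subst f_eq, rule G.norm_residual_le_of_residual[OF b _ hG]) (auto intro: uG z)
    also have "\<dots> \<le> s"
    proof (rule field_le_epsilon)
      fix e :: real assume e: "e > 0"
      \<comment> \<open>An error \<open>e'\<close> in the \<open>F\<close>-norm enlarges the \<open>G\<close>-norm by at most \<open>(s + C) e'\<close>.\<close>
      define e' where "e' = e / (s + C + 1)"
      have e': "e' > 0" "(s + C) * e' \<le> e" using e s C(1) by (auto simp: e'_def field_simps)
      obtain k where k: "k \<in> F" "\<And>j. j < m \<Longrightarrow> L j k = 0"
        and hk: "F_norm ip (\<lambda>x. h x - k x) < e'"
        using dense[OF f(1) e'(1)] unfolding h_def by blast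
      have d: "(\<lambda>x. h x - k x) \<in> F" using h k by (intro F.diff_in)
      have kG: "k \<in> L2 \<mu>" using k F_subset by auto
      have nk: "F_norm ip k \<le> 1 + e'"
      proof -
        have "F_norm ip k = F_norm ip (\<lambda>x. h x + (-1) * (h x - k x))" by simp
        also have "\<dots> \<le> F_norm ip h + F_norm ip (\<lambda>x. (-1) * (h x - k x))"
          using h d by (intro F.norm_triangle F.scale_in)
        also have "\<dots> = F_norm ip h + F_norm ip (\<lambda>x. h x - k x)"
          using F.norm_scale[OF d, of "-1"] by simp
        finally show ?thesis using h hk by simp
      qed
      have "l2_norm \<mu> h = l2_norm \<mu> (\<lambda>x. k x + (h x - k x))" by simp
      also have "\<dots> \<le> l2_norm \<mu> k + l2_norm \<mu> (\<lambda>x. h x - k x)"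
        unfolding l2_norm_eq_F_norm using kG hG by (intro G.norm_triangle G.diff_in)
      also have "\<dots> \<le> s * F_norm ip k + C * F_norm ip (\<lambda>x. h x - k x)"
        using kernel_norm_le[OF L \<phi> err s k] C(2)[OF d] by (rule add_mono)
      also have "\<dots> \<le> s * (1 + e') + C * e'"
        using nk hk s C by (intro add_mono mult_left_mono) auto
      also have "\<dots> \<le> s + e" using e'(2) by (simp add: algebra_simps)
      finally show "F_norm (l2_inner \<mu>) h \<le> s + e" by (simp add: l2_norm_eq_F_norm)
    qed
    finally show ?thesis by (simp add: l2_norm_eq_F_norm)
  qed
  then show ?thesis using r r' b by (intro exI[of _ r] exI[of _ b]) auto
qed

end

section \<open>Determinants of orthonormal systems at random points\<close>

text \<open>
  The determinant of the matrix with entries \<open>M i j\<close>, \<open>i, j < r\<close>.  The Leibniz formula is the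
  convenient form here: with \<open>M i j = \<phi>\<^sub>i(x\<^sub>j)\<close> each summand is a product over the points, which
  integrates factor by factor.  The number of rows is an ordinary variable because it is only known
  to be at most \<open>m\<close>.
\<close>
definition leibniz_det :: "nat \<Rightarrow> (nat \<Rightarrow> nat \<Rightarrow> real) \<Rightarrow> real" where
  "leibniz_det r M = (\<Sum>p | p permutes {..<r}. of_int (sign p) * (\<Prod>j<r. M (p j) j))"

lemma permutes_lessThan: "p permutes {..<r} \<Longrightarrow> j < r \<Longrightarrow> p j < (r::nat)"
  using permutes_in_image[of p "{..<r}" j] by simp

lemma leibniz_det_cong: "(\<And>i j. i < r \<Longrightarrow> j < r \<Longrightarrow> M i j = M' i j) \<Longrightarrow> leibniz_det r M = leibniz_det r M'"
  unfolding leibniz_det_def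
  by (intro sum.cong prod.cong arg_cong2[of _ _ _ _ "(*)"]) (auto simp: permutes_lessThan)

text \<open>
  Composing all permutations with the transposition of \<open>k\<close> and \<open>l\<close> reproduces the sum with the
  opposite sign.
\<close>
lemma leibniz_det_equal_rows:
  assumes "k < r" "l < r" "k \<noteq> l" and eq: "\<And>j. j < r \<Longrightarrow> M k j = M l j"
  shows "leibniz_det r M = 0"
proof -
  let ?t = "Transposition.transpose k l"
  have t: "?t permutes {..<r}" using assms by (intro permutes_swap_id) auto
  have "leibniz_det r M = (\<Sum>p | p permutes {..<r}. of_int (sign (?t \<circ> p)) * (\<Prod>j<r. M ((?t \<circ> p) j) j))"
    unfolding leibniz_det_def by (rule setum_permutations_compose_left[OF t])
  also have "\<dots> = (\<Sum>p | p permutes {..<r}. - (of_int (sign p) * (\<Prod>j<r. M (p j) j)))"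
  proof (rule sum.cong[OF refl])
    fix p assume "p \<in> {p. p permutes {..<r}}"
    then have p: "p permutes {..<r}" by simp
    have "sign (?t \<circ> p) = - sign p"
      using permutes_imp_permutation[OF _ p] permutes_imp_permutation[OF _ t] \<open>k \<noteq> l\<close>
      by (simp add: sign_compose sign_swap_id)
    moreover have "(\<Prod>j<r. M ((?t \<circ> p) j) j) = (\<Prod>j<r. M (p j) j)"
      using eq by (intro prod.cong refl) (auto simp: Transposition.transpose_def)
    ultimately show "of_int (sign (?t \<circ> p)) * (\<Prod>j<r. M ((?t \<circ> p) j) j)
        = - (of_int (sign p) * (\<Prod>j<r. M (p j) j))" by simp
  qed
  also have "\<dots> = - leibniz_det r M" by (simp add: leibniz_det_def sum_negf)
  finally show ?thesis by simp
qed

text \<open>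
  Exactly one factor of each summand stems from row \<open>k\<close>; isolating it exhibits linearity in that row.
\<close>
lemma leibniz_det_row_expansion:
  assumes k: "k < r"
  shows "leibniz_det r (M(k := v)) = (\<Sum>p | p permutes {..<r}.
     of_int (sign p) * (\<Prod>j\<in>{..<r} - {inv p k}. M (p j) j) * v (inv p k))"
  unfolding leibniz_det_def
proof (rule sum.cong[OF refl])
  fix p assume "p \<in> {p. p permutes {..<r}}"
  then have p: "p permutes {..<r}" by simp
  have ik: "inv p k < r" using permutes_inv[OF p] k permutes_in_image[of "inv p" "{..<r}" k] by simp
  have "(\<Prod>j<r. (M(k := v)) (p j) j)
      = (M(k := v)) (p (inv p k)) (inv p k) * (\<Prod>j\<in>{..<r} - {inv p k}. (M(k := v)) (p j) j)"
    using ik by (intro prod.remove) auto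
  also have "(\<Prod>j\<in>{..<r} - {inv p k}. (M(k := v)) (p j) j) = (\<Prod>j\<in>{..<r} - {inv p k}. M (p j) j)"
    using permutes_inverses(2)[OF p] by (intro prod.cong) auto
  finally show "of_int (sign p) * (\<Prod>j<r. (M(k := v)) (p j) j)
      = of_int (sign p) * (\<Prod>j\<in>{..<r} - {inv p k}. M (p j) j) * v (inv p k)"
    using permutes_inverses(1)[OF p] by simp
qed

text \<open>
  The core of Cramer's rule, with an additional perturbation \<open>g\<close> of the right-hand side.
\<close>
lemma leibniz_det_row_combination:
  assumes k: "k < r"
  shows "leibniz_det r (M(k := \<lambda>j. (\<Sum>l<r. c l * M l j) + g j)) = c k * leibniz_det r M + leibniz_det r (M(k := g))"
proof -
  define w where "w p = of_int (sign p) * (\<Prod>j\<in>{..<r} - {inv p k}. M (p j) j)" for p :: "nat \<Rightarrow> nat"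
  let ?S = "{p. p permutes {..<r}}"
  have row: "leibniz_det r (M(k := v)) = (\<Sum>p\<in>?S. w p * v (inv p k))" for v
    unfolding w_def by (rule leibniz_det_row_expansion[OF k])
  have "leibniz_det r (M(k := \<lambda>j. (\<Sum>l<r. c l * M l j) + g j))
      = (\<Sum>p\<in>?S. \<Sum>l<r. c l * (w p * M l (inv p k))) + (\<Sum>p\<in>?S. w p * g (inv p k))"
    by (simp add: row distrib_left sum.distrib sum_distrib_left mult_ac)
  also have "(\<Sum>p\<in>?S. \<Sum>l<r. c l * (w p * M l (inv p k))) = (\<Sum>l<r. c l * leibniz_det r (M(k := M l)))"
    by (subst sum.swap) (simp add: row sum_distrib_left)
  also have "\<dots> = (\<Sum>l<r. if l = k then c k * leibniz_det r M else 0)"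
  proof (rule sum.cong[OF refl])
    fix l assume l: "l \<in> {..<r}"
    show "c l * leibniz_det r (M(k := M l)) = (if l = k then c k * leibniz_det r M else 0)"
      using leibniz_det_equal_rows[of k r l "M(k := M l)"] k l by auto
  qed
  also have "\<dots> = c k * leibniz_det r M" using k by simp
  finally show ?thesis by (simp only: row)
qed

lemma leibniz_det_measurable:
  assumes "\<And>i j. i < r \<Longrightarrow> j < r \<Longrightarrow> (\<lambda>\<omega>. M \<omega> i j) \<in> borel_measurable N"
  shows "(\<lambda>\<omega>. leibniz_det r (M \<omega>)) \<in> borel_measurable N"
  unfolding leibniz_det_def
  by (intro borel_measurable_sum borel_measurable_times borel_measurable_const borel_measurable_prod assms)
    (auto simp: permutes_lessThan)

text \<open>
  Expanding the square gives a double sum over permutations \<open>p\<close>, \<open>q\<close>; by Fubini each summand is a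
  product of inner products of \<open>\<phi>\<^bsub>p j\<^esub>\<close> and \<open>\<phi>\<^bsub>q j\<^esub>\<close>, which vanishes unless \<open>p = q\<close>.
\<close>
lemma leibniz_det_sq_integral:
  assumes \<mu>: "prob_space \<mu>" and L2: "\<And>i. i < r \<Longrightarrow> \<phi> i \<in> L2 \<mu>"
    and orth: "\<And>i j. i < r \<Longrightarrow> j < r \<Longrightarrow> i \<noteq> j \<Longrightarrow> l2_inner \<mu> (\<phi> i) (\<phi> j) = 0"
  shows "integrable (\<Pi>\<^sub>M j\<in>{..<r}. \<mu>) (\<lambda>x. (leibniz_det r (\<lambda>i j. \<phi> i (x j)))\<^sup>2)" (is ?int)
    and "(\<integral>x. (leibniz_det r (\<lambda>i j. \<phi> i (x j)))\<^sup>2 \<partial>(\<Pi>\<^sub>M j\<in>{..<r}. \<mu>))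
       = fact r * (\<Prod>i<r. l2_inner \<mu> (\<phi> i) (\<phi> i))" (is ?eq)
proof -
  interpret \<mu>: prob_space \<mu> by fact
  interpret product_sigma_finite "\<lambda>_::nat. \<mu>" by standard
  let ?S = "{p. p permutes {..<r}}" and ?P = "\<Pi>\<^sub>M j\<in>{..<r}. \<mu>"
  define T where "T p q x = (\<Prod>j<r. \<phi> (p j) (x j) * \<phi> (q j) (x j))" for p q :: "nat \<Rightarrow> nat" and x :: "nat \<Rightarrow> 'a"
  have expand: "(leibniz_det r (\<lambda>i j. \<phi> i (x j)))\<^sup>2
      = (\<Sum>p\<in>?S. \<Sum>q\<in>?S. of_int (sign p) * of_int (sign q) * T p q x)" for x
    unfolding leibniz_det_def power2_eq_square T_def prod.distrib
    by (simp add: sum_product mult_ac)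
  have int1: "integrable \<mu> (\<lambda>t. \<phi> (p j) t * \<phi> (q j) t)" if "p \<in> ?S" "q \<in> ?S" "j < r" for p q j
    using that by (intro L2_mult_integrable L2) (auto simp: permutes_lessThan)
  have intT: "integrable ?P (T p q)" if "p \<in> ?S" "q \<in> ?S" for p q
    unfolding T_def by (rule product_integrable_prod) (use int1[OF that] in auto)
  have T: "(\<integral>x. T p q x \<partial>?P) = (if p = q then (\<Prod>i<r. l2_inner \<mu> (\<phi> i) (\<phi> i)) else 0)"
    if pq: "p \<in> ?S" "q \<in> ?S" for p q
  proof -
    have "(\<integral>x. T p q x \<partial>?P) = (\<Prod>j<r. l2_inner \<mu> (\<phi> (p j)) (\<phi> (q j)))"
      unfolding T_def l2_inner_def by (rule product_integral_prod) (use int1[OF pq] in auto)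
    also have "\<dots> = (if p = q then (\<Prod>i<r. l2_inner \<mu> (\<phi> i) (\<phi> i)) else 0)"
    proof (cases "p = q")
      case True
      then show ?thesis
        using prod.permute[of p "{..<r}" "\<lambda>i. l2_inner \<mu> (\<phi> i) (\<phi> i)"] pq by (simp add: comp_def)
    next
      case False
      have "\<exists>j<r. p j \<noteq> q j"
      proof (rule ccontr)
        assume "\<not> ?thesis"
        then have "p j = q j" for j using pq by (cases "j < r") (auto simp: permutes_def)
        with False show False by auto
      qed
      then obtain j where "j < r" "p j \<noteq> q j" by auto
      then have "l2_inner \<mu> (\<phi> (p j)) (\<phi> (q j)) = 0"
        using pq by (intro orth) (auto simp: permutes_lessThan)
      with \<open>j < r\<close> False show ?thesis by auto
    qed
    finally show ?thesis .
  qed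
  show ?int unfolding expand
    by (intro Bochner_Integration.integrable_sum Bochner_Integration.integrable_mult_right intT) auto
  have "(\<integral>x. (leibniz_det r (\<lambda>i j. \<phi> i (x j)))\<^sup>2 \<partial>?P)
      = (\<Sum>p\<in>?S. \<integral>x. (\<Sum>q\<in>?S. of_int (sign p) * of_int (sign q) * T p q x) \<partial>?P)"
    unfolding expand
    by (intro Bochner_Integration.integral_sum Bochner_Integration.integrable_sum
        Bochner_Integration.integrable_mult_right intT)
  also have "\<dots> = (\<Sum>p\<in>?S. \<Sum>q\<in>?S. \<integral>x. of_int (sign p) * of_int (sign q) * T p q x \<partial>?P)"
    by (intro sum.cong refl Bochner_Integration.integral_sum
        Bochner_Integration.integrable_mult_right intT)
  also have "\<dots> = (\<Sum>p\<in>?S. \<Sum>q\<in>?S. of_int (sign p) * of_int (sign q) * (\<integral>x. T p q x \<partial>?P))"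
    by simp
  also have "\<dots> = (\<Sum>p\<in>?S. \<Sum>q\<in>?S. if p = q then (\<Prod>i<r. l2_inner \<mu> (\<phi> i) (\<phi> i)) else 0)"
    by (intro sum.cong refl) (auto simp: T sign_def)
  also have "\<dots> = (\<Sum>p\<in>?S. (\<Prod>i<r. l2_inner \<mu> (\<phi> i) (\<phi> i)))"
    by (intro sum.cong refl) (simp add: finite_permutations)
  also have "\<dots> = fact r * (\<Prod>i<r. l2_inner \<mu> (\<phi> i) (\<phi> i))"
    using card_permutations[of "{..<r}" r] by simp
  finally show ?eq .
qed

section \<open>The reconstruction\<close>

text \<open>
  Coefficient \<open>k\<close>, according to Cramer's rule, of the combination of the \<open>b\<^sub>i\<close> that interpolates the
  values \<open>y\<^sub>j\<close> at the points \<open>x\<^sub>j\<close>.  It is zero by convention if the matrix is singular, an event to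
  which the sampling density assigns probability zero.
\<close>
definition cramer_start :: "nat \<Rightarrow> (nat \<Rightarrow> 'x \<Rightarrow> real) \<Rightarrow> (nat \<Rightarrow> 'x) \<Rightarrow> (nat \<Rightarrow> real) \<Rightarrow> nat \<Rightarrow> real" where
  "cramer_start r b x y k = leibniz_det r ((\<lambda>i j. b i (x j))(k := y)) / leibniz_det r (\<lambda>i j. b i (x j))"

text \<open>
  State after a number of regularized Kaczmarz steps with points \<open>z\<close>, data \<open>y\<close> and initial
  coefficients \<open>c\<close>.  The summand \<open>1\<close> in the denominator keeps it away from zero where all \<open>b\<^sub>i\<close> vanish,
  and covers \<open>r = 0\<close>.
\<close>
primrec kaczmarz ::
  "nat \<Rightarrow> (nat \<Rightarrow> 'x \<Rightarrow> real) \<Rightarrow> (nat \<Rightarrow> 'x) \<Rightarrow> (nat \<Rightarrow> real) \<Rightarrow> (nat \<Rightarrow> real) \<Rightarrow> nat \<Rightarrow> nat \<Rightarrow> real" where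
  "kaczmarz r b z y c 0 = c"
| "kaczmarz r b z y c (Suc t) = (\<lambda>k. kaczmarz r b z y c t k +
     (y t - (\<Sum>i<r. kaczmarz r b z y c t i * b i (z t))) * b k (z t) / (1 + (\<Sum>i<r. (b i (z t))\<^sup>2)))"

lemma cramer_start_cong: "(\<And>j. j < r \<Longrightarrow> y j = y' j) \<Longrightarrow> cramer_start r b x y = cramer_start r b x y'"
  unfolding cramer_start_def by (intro ext arg_cong2[of _ _ _ _ "(/)"] leibniz_det_cong) auto

lemma kaczmarz_cong:
  "(\<And>i. i < t \<Longrightarrow> y i = y' i \<and> z i = z' i) \<Longrightarrow> kaczmarz r b z y c t = kaczmarz r b z' y' c t"
  by (induction t) auto

lemma kaczmarz_measurable:
  assumes b: "\<And>i. i < r \<Longrightarrow> b i \<in> borel_measurable \<mu>"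
    and "\<And>t. t < T \<Longrightarrow> (\<lambda>\<omega>. z \<omega> t) \<in> M \<rightarrow>\<^sub>M \<mu>"
    and "\<And>t. t < T \<Longrightarrow> (\<lambda>\<omega>. y \<omega> t) \<in> borel_measurable M"
    and c: "\<And>k. k < r \<Longrightarrow> (\<lambda>\<omega>. c \<omega> k) \<in> borel_measurable M"
    and "k < r"
  shows "(\<lambda>\<omega>. kaczmarz r b (z \<omega>) (y \<omega>) (c \<omega>) T k) \<in> borel_measurable M"
  using assms(2,3,5)
proof (induction T arbitrary: k)
  case (Suc T)
  have bz: "(\<lambda>\<omega>. b i (z \<omega> T)) \<in> borel_measurable M" if "i < r" for i
    using measurable_compose[OF Suc.prems(1)[of T] b[OF that]] by simp
  have IH: "(\<lambda>\<omega>. kaczmarz r b (z \<omega>) (y \<omega>) (c \<omega>) T i) \<in> borel_measurable M" if "i < r" for i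
    using Suc.IH Suc.prems that by simp
  show ?case unfolding kaczmarz.simps
    using Suc.prems(2)[of T] Suc.prems(3) IH bz
    by (intro borel_measurable_add borel_measurable_divide borel_measurable_times
        borel_measurable_diff borel_measurable_sum borel_measurable_power borel_measurable_const) auto
qed (use c in simp)

lemma cramer_start_measurable:
  assumes b: "\<And>i. i < r \<Longrightarrow> b i \<in> borel_measurable \<mu>"
    and x: "\<And>j. j < r \<Longrightarrow> (\<lambda>\<omega>. x \<omega> j) \<in> M \<rightarrow>\<^sub>M \<mu>"
    and y: "\<And>j. j < r \<Longrightarrow> (\<lambda>\<omega>. y \<omega> j) \<in> borel_measurable M"
  shows "(\<lambda>\<omega>. cramer_start r b (x \<omega>) (y \<omega>) k) \<in> borel_measurable M"
proof -
  have bx: "(\<lambda>\<omega>. b i (x \<omega> j)) \<in> borel_measurable M" if "i < r" "j < r" for i j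
    using measurable_compose[OF x[OF that(2)] b[OF that(1)]] .
  show ?thesis unfolding cramer_start_def
    by (intro borel_measurable_divide leibniz_det_measurable, case_tac "i = k") (auto simp: bx y)
qed

text \<open>
  Interpolation is exact on the span of the \<open>b\<^sub>i\<close>, so only the perturbation \<open>g\<close> enters the error.
\<close>
lemma cramer_start_error:
  assumes k: "k < r" and f: "\<And>j. j < r \<Longrightarrow> f (x j) = (\<Sum>l<r. c l * b l (x j)) + g (x j)"
    and ne: "leibniz_det r (\<lambda>i j. b i (x j)) \<noteq> 0"
  shows "cramer_start r b x (\<lambda>j. f (x j)) k - c k
     = leibniz_det r (\<lambda>i j. (b(k := g)) i (x j)) / leibniz_det r (\<lambda>i j. b i (x j))"
proof -
  let ?M = "\<lambda>i j. b i (x j)"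
  have "leibniz_det r (?M(k := \<lambda>j. f (x j))) = leibniz_det r (?M(k := \<lambda>j. (\<Sum>l<r. c l * ?M l j) + g (x j)))"
    using f by (intro leibniz_det_cong) auto
  also have "\<dots> = c k * leibniz_det r ?M + leibniz_det r (?M(k := \<lambda>j. g (x j)))"
    by (rule leibniz_det_row_combination[OF k])
  also have "?M(k := \<lambda>j. g (x j)) = (\<lambda>i j. (b(k := g)) i (x j))" by auto
  finally show ?thesis using ne by (simp only: cramer_start_def) (simp add: field_simps del: fun_upd_apply)
qed

text \<open>
  Effect of one step on the coefficient error \<open>\<delta>\<close>, where \<open>\<beta>\<close> and \<open>g\<close> are the values of the \<open>b\<^sub>i\<close> and of
  the residual at the new point.  The factor \<open>1 + B\<close> is the sampling density up to normalization; with
  it the mixed term \<open>g s\<close> cancels pointwise, and the bound can be integrated term by term.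
\<close>
lemma kaczmarz_step_bound:
  fixes \<delta> \<beta> :: "nat \<Rightarrow> real" and g :: real and r :: nat
  defines "B \<equiv> \<Sum>i<r. (\<beta> i)\<^sup>2" and "s \<equiv> \<Sum>i<r. \<delta> i * \<beta> i"
  shows "(\<Sum>k<r. (\<delta> k + (g - s) * \<beta> k / (1 + B))\<^sup>2) * (1 + B) \<le> (\<Sum>k<r. (\<delta> k)\<^sup>2) * (1 + B) + g\<^sup>2 - s\<^sup>2"
proof -
  define u where "u = (g - s) / (1 + B)"
  have B: "B \<ge> 0" unfolding B_def by (intro sum_nonneg) auto
  have u: "u * (1 + B) = g - s" using B by (simp add: u_def)
  have "(\<Sum>k<r. (\<delta> k + (g - s) * \<beta> k / (1 + B))\<^sup>2) = (\<Sum>k<r. (\<delta> k)\<^sup>2 + 2 * u * (\<delta> k * \<beta> k) + u\<^sup>2 * (\<beta> k)\<^sup>2)"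
    by (intro sum.cong refl) (simp add: u_def power2_sum power_mult_distrib power_divide mult_ac)
  also have "\<dots> = (\<Sum>k<r. (\<delta> k)\<^sup>2) + 2 * u * s + u\<^sup>2 * B"
    by (simp add: sum.distrib B_def s_def sum_distrib_left)
  finally have "(\<Sum>k<r. (\<delta> k + (g - s) * \<beta> k / (1 + B))\<^sup>2) * (1 + B)
      = (\<Sum>k<r. (\<delta> k)\<^sup>2) * (1 + B) + 2 * (u * (1 + B)) * s + u * B * (u * (1 + B))"
    by (simp add: algebra_simps power2_eq_square)
  also have "\<dots> = (\<Sum>k<r. (\<delta> k)\<^sup>2) * (1 + B) + 2 * (g - s) * s + u * B * (g - s)"
    by (simp only: u)
  also have "u * B * (g - s) = (g - s)\<^sup>2 * (B / (1 + B))"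
    by (simp add: u_def power2_eq_square)
  also have "\<dots> \<le> (g - s)\<^sup>2 * 1" using B by (intro mult_left_mono) auto
  finally show ?thesis by (simp add: power2_eq_square algebra_simps)
qed

section \<open>Expected error under the sampling distributions\<close>

locale orthonormal_system = prob_space \<mu>
  for \<mu> :: "'x measure" +
  fixes r :: nat and b :: "nat \<Rightarrow> 'x \<Rightarrow> real"
  assumes b: "orthonormal (L2 \<mu>) (l2_inner \<mu>) r b"
begin

sublocale G: function_inner_space "L2 \<mu>" "l2_inner \<mu>"
  by (rule L2_inner_space)

text \<open>The diagonal of the reproducing kernel of the span, that is, the reciprocal of the Christoffel
  function.\<close>
definition kernel_diag :: "'x \<Rightarrow> real" where
  "kernel_diag x = (\<Sum>i<r. (b i x)\<^sup>2)"

text \<open>The law of one point of the second stage.  Adding \<open>1\<close> to the diagonal mixes in the law \<open>\<mu>\<close>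
  itself, with the normalizing factor \<open>1 + r\<close>.\<close>
definition \<nu> :: "'x measure" where
  "\<nu> = density \<mu> (\<lambda>x. ennreal ((1 + kernel_diag x) / (1 + real r)))"

text \<open>The joint law of the interpolation points, known as a projection determinantal point process.\<close>
definition \<pi> :: "(nat \<Rightarrow> 'x) measure" where
  "\<pi> = density (\<Pi>\<^sub>M j\<in>{..<r}. \<mu>) (\<lambda>x. ennreal ((leibniz_det r (\<lambda>i j. b i (x j)))\<^sup>2 / fact r))"

lemma b_L2: "i < r \<Longrightarrow> b i \<in> L2 \<mu>"
  using G.orthonormalD(1)[OF b] .

lemma b_measurable [measurable]: "i < r \<Longrightarrow> b i \<in> borel_measurable \<mu>"
  using b_L2 by (simp add: L2_def)

lemma kernel_diag_nonneg: "kernel_diag x \<ge> 0"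
  unfolding kernel_diag_def by (intro sum_nonneg) auto

lemma kernel_diag_measurable [measurable]: "kernel_diag \<in> borel_measurable \<mu>"
  unfolding kernel_diag_def by measurable

lemma kernel_diag_integrable: "integrable \<mu> kernel_diag" and kernel_diag_integral: "(\<integral>x. kernel_diag x \<partial>\<mu>) = real r"
proof -
  have i: "integrable \<mu> (\<lambda>x. (b i x)\<^sup>2)" if "i < r" for i
    using b_L2[OF that] by (simp add: L2_def)
  have "(\<integral>x. (b i x)\<^sup>2 \<partial>\<mu>) = 1" if "i < r" for i
    using G.orthonormalD(2)[OF b that that] by (simp add: l2_inner_def power2_eq_square)
  then show "integrable \<mu> kernel_diag" "(\<integral>x. kernel_diag x \<partial>\<mu>) = real r"
    unfolding kernel_diag_def using i by (auto simp: Bochner_Integration.integral_sum)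
qed

lemma space_\<nu> [simp]: "space \<nu> = space \<mu>" and sets_\<nu> [measurable_cong, simp]: "sets \<nu> = sets \<mu>"
  by (auto simp: \<nu>_def)

lemma prob_space_\<nu>: "prob_space \<nu>"
proof (rule prob_spaceI)
  have "emeasure \<nu> (space \<nu>) = (\<integral>\<^sup>+x. ennreal ((1 + kernel_diag x) / (1 + real r)) \<partial>\<mu>)"
    unfolding \<nu>_def by (simp add: emeasure_density cong: nn_integral_cong)
  also have "\<dots> = ennreal (\<integral>x. (1 + kernel_diag x) / (1 + real r) \<partial>\<mu>)"
    using kernel_diag_integrable kernel_diag_nonneg by (intro nn_integral_eq_integral) auto
  also have "(\<integral>x. (1 + kernel_diag x) / (1 + real r) \<partial>\<mu>) = 1"
    using kernel_diag_integrable by (simp add: kernel_diag_integral prob_space)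
  finally show "emeasure \<nu> (space \<nu>) = 1" by simp
qed

lemma leibniz_det_system_measurable:
  assumes "\<And>i. i < r \<Longrightarrow> \<phi> i \<in> borel_measurable \<mu>"
  shows "(\<lambda>x. leibniz_det r (\<lambda>i j. \<phi> i (x j))) \<in> borel_measurable (\<Pi>\<^sub>M j\<in>{..<r}. \<mu>)"
  using assms by (intro leibniz_det_measurable measurable_compose[OF measurable_component_singleton]) auto

lemma prob_space_\<pi>: "prob_space \<pi>"
proof (rule prob_spaceI)
  let ?P = "\<Pi>\<^sub>M j\<in>{..<r}. \<mu>" and ?d = "\<lambda>x. leibniz_det r (\<lambda>i j. b i (x j))"
  have m: "?d \<in> borel_measurable ?P" by (intro leibniz_det_system_measurable) auto
  have d: "integrable ?P (\<lambda>x. (?d x)\<^sup>2)" "(\<integral>x. (?d x)\<^sup>2 \<partial>?P) = fact r"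
    using leibniz_det_sq_integral[of \<mu> r b] prob_space_axioms b_L2 G.orthonormalD(2)[OF b] by auto
  have "emeasure \<pi> (space \<pi>) = (\<integral>\<^sup>+x. ennreal ((?d x)\<^sup>2 / fact r) \<partial>?P)"
    unfolding \<pi>_def using m by (simp add: emeasure_density cong: nn_integral_cong)
  also have "\<dots> = ennreal (\<integral>x. (?d x)\<^sup>2 / fact r \<partial>?P)"
    using d by (intro nn_integral_eq_integral) auto
  also have "(\<integral>x. (?d x)\<^sup>2 / fact r \<partial>?P) = 1" using d by simp
  finally show "emeasure \<pi> (space \<pi>) = 1" by simp
qed

lemma space_\<pi>: "space \<pi> = (\<Pi>\<^sub>E j\<in>{..<r}. space \<mu>)"
  and sets_\<pi> [measurable_cong, simp]: "sets \<pi> = sets (\<Pi>\<^sub>M j\<in>{..<r}. \<mu>)"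
  by (auto simp: \<pi>_def space_PiM)

text \<open>
  The density \<open>det\<^sup>2 / r!\<close> cancels the denominator in \<open>cramer_start_error\<close>.  What remains is the
  squared determinant of the system in which \<open>b\<^sub>k\<close> is replaced by \<open>g\<close>; this system is still orthogonal,
  so its integral is \<open>r! \<parallel>g\<parallel>\<^sup>2\<close>.
\<close>
lemma cramer_start_expectation:
  assumes f: "f \<in> L2 \<mu>"
  defines "c \<equiv> \<lambda>k. l2_inner \<mu> f (b k)" and "g \<equiv> residual (l2_inner \<mu>) r b f"
  shows "(\<integral>\<^sup>+x. ennreal (\<Sum>k<r. (cramer_start r b x (\<lambda>j. f (x j)) k - c k)\<^sup>2) \<partial>\<pi>) \<le> ennreal (r * l2_inner \<mu> g g)"
proof -
  let ?P = "\<Pi>\<^sub>M j\<in>{..<r}. \<mu>" and ?d = "\<lambda>x. leibniz_det r (\<lambda>i j. b i (x j))"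
  let ?s = "\<lambda>x k. cramer_start r b x (\<lambda>j. f (x j)) k"
  define n where "n k x = leibniz_det r (\<lambda>i j. (b(k := g)) i (x j))" for k x
  have g: "g \<in> L2 \<mu>" unfolding g_def using b f by (rule G.residual_in)
  have gb: "l2_inner \<mu> g (b j) = 0" if "j < r" for j
    unfolding g_def using G.residual_orthogonal[OF b f that] .
  have bg: "l2_inner \<mu> (b j) g = 0" if "j < r" for j
    using gb[OF that] G.commute[OF g b_L2[OF that]] by simp
  have fm: "f \<in> borel_measurable \<mu>" using f by (simp add: L2_def)
  have m: "?d \<in> borel_measurable ?P" by (intro leibniz_det_system_measurable) auto
  have fx: "(\<lambda>x. f (x j)) \<in> borel_measurable ?P" if "j < r" for j
    using that by (intro measurable_compose[OF _ fm] measurable_component_singleton) simp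
  have sm: "(\<lambda>x. ?s x k) \<in> borel_measurable ?P" for k
    by (rule cramer_start_measurable[where \<mu>=\<mu>]) (auto intro: fx)
  have n: "integrable ?P (\<lambda>x. (n k x)\<^sup>2)" "(\<integral>x. (n k x)\<^sup>2 \<partial>?P) = fact r * l2_inner \<mu> g g"
    if k: "k < r" for k
  proof -
    have L: "(b(k := g)) i \<in> L2 \<mu>" if "i < r" for i using g b_L2[OF that] by simp
    have o: "l2_inner \<mu> ((b(k := g)) i) ((b(k := g)) j) = 0" if "i < r" "j < r" "i \<noteq> j" for i j
      using that gb bg G.orthonormalD(2)[OF b] by auto
    have "(\<Prod>i<r. l2_inner \<mu> ((b(k := g)) i) ((b(k := g)) i)) = (\<Prod>i<r. if i = k then l2_inner \<mu> g g else 1)"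
      using G.orthonormalD(2)[OF b] by (intro prod.cong) auto
    also have "\<dots> = l2_inner \<mu> g g" using k by simp
    finally show "integrable ?P (\<lambda>x. (n k x)\<^sup>2)" "(\<integral>x. (n k x)\<^sup>2 \<partial>?P) = fact r * l2_inner \<mu> g g"
      unfolding n_def using leibniz_det_sq_integral[OF prob_space_axioms L o] by auto
  qed
  have "(\<integral>\<^sup>+x. ennreal (\<Sum>k<r. (?s x k - c k)\<^sup>2) \<partial>\<pi>)
      = (\<integral>\<^sup>+x. ennreal ((?d x)\<^sup>2 / fact r) * ennreal (\<Sum>k<r. (?s x k - c k)\<^sup>2) \<partial>?P)"
    unfolding \<pi>_def using m sm
    by (intro nn_integral_density measurable_compose[OF _ measurable_ennreal] borel_measurable_sum
        borel_measurable_power borel_measurable_diff borel_measurable_divide) auto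
  also have "\<dots> \<le> (\<integral>\<^sup>+x. ennreal ((\<Sum>k<r. (n k x)\<^sup>2) / fact r) \<partial>?P)"
  proof (rule nn_integral_mono)
    fix x assume "x \<in> space ?P"
    have "(?d x)\<^sup>2 * (\<Sum>k<r. (?s x k - c k)\<^sup>2) \<le> (\<Sum>k<r. (n k x)\<^sup>2)"
    proof (cases "?d x = 0")
      case False
      have "f t = (\<Sum>l<r. c l * b l t) + g t" for t by (simp add: g_def residual_def c_def)
      then have "?s x k - c k = n k x / ?d x" if "k < r" for k
        unfolding n_def using that False by (intro cramer_start_error) auto
      then have "(?d x)\<^sup>2 * (\<Sum>k<r. (?s x k - c k)\<^sup>2) = (\<Sum>k<r. (?d x)\<^sup>2 * (n k x / ?d x)\<^sup>2)"
        by (simp add: sum_distrib_left)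
      also have "\<dots> = (\<Sum>k<r. (n k x)\<^sup>2)"
        using False by (intro sum.cong) (auto simp: power_divide)
      finally show ?thesis by simp
    qed (simp add: sum_nonneg)
    then have "(?d x)\<^sup>2 / fact r * (\<Sum>k<r. (?s x k - c k)\<^sup>2) \<le> (\<Sum>k<r. (n k x)\<^sup>2) / fact r"
      by (simp add: divide_right_mono)
    then show "ennreal ((?d x)\<^sup>2 / fact r) * ennreal (\<Sum>k<r. (?s x k - c k)\<^sup>2)
        \<le> ennreal ((\<Sum>k<r. (n k x)\<^sup>2) / fact r)"
      by (subst ennreal_mult[symmetric]) (auto intro!: ennreal_leI sum_nonneg)
  qed
  also have "\<dots> = ennreal (\<integral>x. (\<Sum>k<r. (n k x)\<^sup>2) / fact r \<partial>?P)"
    using n by (intro nn_integral_eq_integral Bochner_Integration.integrable_divide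
        Bochner_Integration.integrable_sum) (auto intro!: sum_nonneg divide_nonneg_nonneg)
  also have "(\<integral>x. (\<Sum>k<r. (n k x)\<^sup>2) / fact r \<partial>?P) = (\<Sum>k<r. \<integral>x. (n k x)\<^sup>2 \<partial>?P) / fact r"
    using n by (simp add: Bochner_Integration.integral_sum)
  also have "\<dots> = r * l2_inner \<mu> g g" by (simp add: n sum_distrib_left)
  finally show ?thesis .
qed

text \<open>
  Integrating \<open>kaczmarz_step_bound\<close>: the diagonal \<open>\<Sum> b\<^sub>i\<^sup>2\<close> has integral \<open>r\<close> and the square of the error
  function \<open>s = \<Sum> \<delta>\<^sub>i b\<^sub>i\<close> has integral \<open>\<Sum> \<delta>\<^sub>i\<^sup>2\<close>, which produces the contraction.
\<close>
lemma kaczmarz_step_expectation: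
  fixes c' :: "nat \<Rightarrow> real"
  assumes f: "f \<in> L2 \<mu>"
  defines "c \<equiv> \<lambda>k. l2_inner \<mu> f (b k)" and "g \<equiv> residual (l2_inner \<mu>) r b f"
  shows "(\<integral>\<^sup>+x. ennreal (\<Sum>k<r. (c' k + (f x - (\<Sum>i<r. c' i * b i x)) * b k x / (1 + kernel_diag x) - c k)\<^sup>2) \<partial>\<nu>)
     \<le> ennreal ((1 - 1 / (1 + real r)) * (\<Sum>k<r. (c' k - c k)\<^sup>2) + 1 / (1 + real r) * l2_inner \<mu> g g)"
proof -
  define \<delta> where "\<delta> k = c' k - c k" for k
  define s where "s x = (\<Sum>i<r. \<delta> i * b i x)" for x
  define Dq where "Dq = (\<Sum>k<r. (\<delta> k)\<^sup>2)"
  define q where "q x = (\<Sum>k<r. (\<delta> k + (g x - s x) * b k x / (1 + kernel_diag x))\<^sup>2)" for x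
  have g: "g \<in> L2 \<mu>" unfolding g_def using b f by (rule G.residual_in)
  have s: "s \<in> L2 \<mu>" unfolding s_def using b_L2 by (intro G.sum_in) auto
  note [measurable] = g[unfolded L2_def, simplified, THEN conjunct1]
    s[unfolded L2_def, simplified, THEN conjunct1]
  have gs: "integrable \<mu> (\<lambda>x. (g x)\<^sup>2)" "integrable \<mu> (\<lambda>x. (s x)\<^sup>2)"
    using g s by (auto simp: L2_def)
  have res: "f x - (\<Sum>i<r. c' i * b i x) = g x - s x" for x
    by (simp add: g_def residual_def s_def \<delta>_def c_def left_diff_distrib sum_subtractf)
  have q_eq: "(\<Sum>k<r. (c' k + (f x - (\<Sum>i<r. c' i * b i x)) * b k x / (1 + kernel_diag x) - c k)\<^sup>2) = q x" for x
    unfolding res q_def by (simp add: \<delta>_def algebra_simps)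
  have qm: "q \<in> borel_measurable \<mu>" unfolding q_def by measurable
  have bound: "q x * (1 + kernel_diag x) \<le> Dq * (1 + kernel_diag x) + (g x)\<^sup>2 - (s x)\<^sup>2" for x
    using kaczmarz_step_bound[of \<delta> "g x" "\<lambda>i. b i x" r] by (simp add: q_def kernel_diag_def s_def Dq_def)
  have q0: "q x \<ge> 0" for x unfolding q_def by (intro sum_nonneg) auto
  have s2: "(\<integral>x. (s x)\<^sup>2 \<partial>\<mu>) = Dq"
  proof -
    have "l2_inner \<mu> (\<lambda>x. 0 + (\<Sum>i<r. \<delta> i * b i x)) (\<lambda>x. 0 + (\<Sum>i<r. \<delta> i * b i x))
        = l2_inner \<mu> (\<lambda>x. 0) (\<lambda>x. 0) + (\<Sum>i<r. (\<delta> i)\<^sup>2)"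
      by (rule G.norm_sq_orthogonal_add[OF b]) (use b_L2 G.zero_in G.zero_left in auto)
    then show ?thesis by (simp add: s_def Dq_def l2_inner_def power2_eq_square)
  qed
  have "(\<integral>\<^sup>+x. ennreal (q x) \<partial>\<nu>) = (\<integral>\<^sup>+x. ennreal ((1 + kernel_diag x) / (1 + real r)) * ennreal (q x) \<partial>\<mu>)"
    unfolding \<nu>_def using qm by (intro nn_integral_density) measurable
  also have "\<dots> \<le> (\<integral>\<^sup>+x. ennreal ((Dq * (1 + kernel_diag x) + (g x)\<^sup>2 - (s x)\<^sup>2) / (1 + real r)) \<partial>\<mu>)"
  proof (rule nn_integral_mono)
    fix x
    have "(1 + kernel_diag x) / (1 + real r) * q x \<le> (Dq * (1 + kernel_diag x) + (g x)\<^sup>2 - (s x)\<^sup>2) / (1 + real r)"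
      using bound[of x] by (simp add: divide_right_mono mult.commute)
    then show "ennreal ((1 + kernel_diag x) / (1 + real r)) * ennreal (q x)
        \<le> ennreal ((Dq * (1 + kernel_diag x) + (g x)\<^sup>2 - (s x)\<^sup>2) / (1 + real r))"
      using kernel_diag_nonneg[of x] q0[of x] by (subst ennreal_mult[symmetric]) (auto intro!: ennreal_leI)
  qed
  also have "\<dots> = ennreal (\<integral>x. (Dq * (1 + kernel_diag x) + (g x)\<^sup>2 - (s x)\<^sup>2) / (1 + real r) \<partial>\<mu>)"
  proof (rule nn_integral_eq_integral)
    show "integrable \<mu> (\<lambda>x. (Dq * (1 + kernel_diag x) + (g x)\<^sup>2 - (s x)\<^sup>2) / (1 + real r))"
      using gs kernel_diag_integrable by auto
    have "0 \<le> Dq * (1 + kernel_diag x) + (g x)\<^sup>2 - (s x)\<^sup>2" for x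
      using bound[of x] mult_nonneg_nonneg[OF q0[of x], of "1 + kernel_diag x"] kernel_diag_nonneg[of x] by linarith
    then show "AE x in \<mu>. 0 \<le> (Dq * (1 + kernel_diag x) + (g x)\<^sup>2 - (s x)\<^sup>2) / (1 + real r)" by simp
  qed
  also have "(\<integral>x. (Dq * (1 + kernel_diag x) + (g x)\<^sup>2 - (s x)\<^sup>2) / (1 + real r) \<partial>\<mu>)
      = (Dq * (1 + real r) + l2_inner \<mu> g g - Dq) / (1 + real r)"
    using gs kernel_diag_integrable s2 by (simp add: kernel_diag_integral prob_space l2_inner_def power2_eq_square)
  also have "\<dots> = (1 - 1 / (1 + real r)) * Dq + 1 / (1 + real r) * l2_inner \<mu> g g"
  proof -
    define R where "R = 1 + real r"
    have "R \<noteq> 0" by (simp add: R_def)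
    then show ?thesis unfolding R_def[symmetric] by (simp add: field_simps)
  qed
  finally show ?thesis unfolding q_eq by (simp add: Dq_def \<delta>_def)
qed

text \<open>
  Iteration of the affine recursion \<open>E \<mapsto> a E + (1 - a) \<parallel>g\<parallel>\<^sup>2\<close>, integrating over the last point first.
\<close>
lemma kaczmarz_expectation:
  fixes c\<^sub>0 :: "nat \<Rightarrow> real"
  assumes f: "f \<in> L2 \<mu>"
  defines "c \<equiv> \<lambda>k. l2_inner \<mu> f (b k)" and "g \<equiv> residual (l2_inner \<mu>) r b f"
    and "a \<equiv> 1 - 1 / (1 + real r)"
  shows "(\<integral>\<^sup>+z. ennreal (\<Sum>k<r. (kaczmarz r b z (\<lambda>t. f (z t)) c\<^sub>0 N k - c k)\<^sup>2) \<partial>(\<Pi>\<^sub>M t\<in>{..<N}. \<nu>))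
     \<le> ennreal (a ^ N * (\<Sum>k<r. (c\<^sub>0 k - c k)\<^sup>2) + (1 - a ^ N) * l2_inner \<mu> g g)"
proof -
  interpret \<nu>: prob_space \<nu> by (rule prob_space_\<nu>)
  interpret P: product_prob_space "\<lambda>_::nat. \<nu>" by standard
  have fm: "f \<in> borel_measurable \<mu>" using f by (simp add: L2_def)
  have a: "0 \<le> a" "a \<le> 1" by (auto simp: a_def field_simps)
  have G0: "l2_inner \<mu> g g \<ge> 0" by (simp add: l2_inner_def)
  have D0: "(\<Sum>k<r. (v k)\<^sup>2) \<ge> 0" for v :: "nat \<Rightarrow> real" by (intro sum_nonneg) auto
  let ?e = "\<lambda>N z. \<Sum>k<r. (kaczmarz r b z (\<lambda>t. f (z t)) c\<^sub>0 N k - c k)\<^sup>2"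
  have km: "(\<lambda>z. kaczmarz r b z (\<lambda>t. f (z t)) c\<^sub>0 N k) \<in> borel_measurable (\<Pi>\<^sub>M t\<in>{..<N}. \<nu>)" if "k < r" for N k
  proof (rule kaczmarz_measurable[where \<mu>=\<mu>, OF _ _ _ _ that])
    fix t assume t: "t < N"
    show "(\<lambda>z. z t) \<in> (\<Pi>\<^sub>M t\<in>{..<N}. \<nu>) \<rightarrow>\<^sub>M \<mu>"
      using measurable_component_singleton[of t "{..<N}" "\<lambda>_. \<nu>"] t
      by (simp cong: measurable_cong_sets)
    from measurable_compose[OF this fm] show "(\<lambda>z. f (z t)) \<in> borel_measurable (\<Pi>\<^sub>M t\<in>{..<N}. \<nu>)" .
  qed auto
  have em: "(\<lambda>z. ennreal (?e N z)) \<in> borel_measurable (\<Pi>\<^sub>M t\<in>{..<N}. \<nu>)" for N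
    using km[of _ N] by (intro measurable_compose[OF _ measurable_ennreal] borel_measurable_sum
        borel_measurable_power borel_measurable_diff) auto
  show ?thesis
  proof (induction N)
    case 0
    show ?case
      using prob_space.emeasure_space_1[OF prob_space_PiM[of "{} :: nat set" "\<lambda>_. \<nu>", OF prob_space_\<nu>]]
      by simp
  next
    case (Suc N)
    have step: "(\<integral>\<^sup>+x. ennreal (?e (Suc N) (z(N := x))) \<partial>\<nu>)
        \<le> ennreal a * ennreal (?e N z) + ennreal ((1 - a) * l2_inner \<mu> g g)" for z
    proof -
      define c' where "c' = kaczmarz r b z (\<lambda>t. f (z t)) c\<^sub>0 N"
      have "kaczmarz r b (z(N := x)) (\<lambda>t. f ((z(N := x)) t)) c\<^sub>0 N = c'" for x
        unfolding c'_def by (rule kaczmarz_cong) auto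
      then have "?e (Suc N) (z(N := x))
          = (\<Sum>k<r. (c' k + (f x - (\<Sum>i<r. c' i * b i x)) * b k x / (1 + kernel_diag x) - c k)\<^sup>2)" for x
        by (simp add: kernel_diag_def)
      then have "(\<integral>\<^sup>+x. ennreal (?e (Suc N) (z(N := x))) \<partial>\<nu>)
          \<le> ennreal (a * (\<Sum>k<r. (c' k - c k)\<^sup>2) + (1 - a) * l2_inner \<mu> g g)"
        using kaczmarz_step_expectation[OF f, of c'] by (simp add: c_def g_def a_def)
      also have "\<dots> = ennreal a * ennreal (?e N z) + ennreal ((1 - a) * l2_inner \<mu> g g)"
        using a G0 D0[of "\<lambda>k. c' k - c k"] by (simp add: ennreal_plus ennreal_mult c'_def)
      finally show ?thesis .
    qed
    have "(\<integral>\<^sup>+z. ennreal (?e (Suc N) z) \<partial>(\<Pi>\<^sub>M t\<in>{..<Suc N}. \<nu>))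
        = (\<integral>\<^sup>+z. (\<integral>\<^sup>+x. ennreal (?e (Suc N) (z(N := x))) \<partial>\<nu>) \<partial>(\<Pi>\<^sub>M t\<in>{..<N}. \<nu>))"
      unfolding lessThan_Suc using em[of "Suc N"]
      by (intro P.product_nn_integral_insert) (auto simp: lessThan_Suc)
    also have "\<dots> \<le> (\<integral>\<^sup>+z. ennreal a * ennreal (?e N z) + ennreal ((1 - a) * l2_inner \<mu> g g) \<partial>(\<Pi>\<^sub>M t\<in>{..<N}. \<nu>))"
      by (intro nn_integral_mono step)
    also have "\<dots> = ennreal a * (\<integral>\<^sup>+z. ennreal (?e N z) \<partial>(\<Pi>\<^sub>M t\<in>{..<N}. \<nu>)) + ennreal ((1 - a) * l2_inner \<mu> g g)"
      using em[of N] prob_space.emeasure_space_1[OF prob_space_PiM[of "{..<N}" "\<lambda>_. \<nu>", OF prob_space_\<nu>]]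
      by (subst nn_integral_add) (auto simp: nn_integral_cmult)
    also have "\<dots> \<le> ennreal a * ennreal (a ^ N * (\<Sum>k<r. (c\<^sub>0 k - c k)\<^sup>2) + (1 - a ^ N) * l2_inner \<mu> g g)
        + ennreal ((1 - a) * l2_inner \<mu> g g)"
      by (intro add_right_mono mult_left_mono Suc.IH) simp
    also have "\<dots> = ennreal (a * (a ^ N * (\<Sum>k<r. (c\<^sub>0 k - c k)\<^sup>2) + (1 - a ^ N) * l2_inner \<mu> g g)
        + (1 - a) * l2_inner \<mu> g g)"
      using a G0 D0[of "\<lambda>k. c\<^sub>0 k - c k"] power_le_one[OF a, of N]
      by (subst ennreal_plus, simp, simp, subst ennreal_mult[symmetric])
         (auto intro!: add_nonneg_nonneg mult_nonneg_nonneg)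
    also have "a * (a ^ N * (\<Sum>k<r. (c\<^sub>0 k - c k)\<^sup>2) + (1 - a ^ N) * l2_inner \<mu> g g) + (1 - a) * l2_inner \<mu> g g
        = a ^ Suc N * (\<Sum>k<r. (c\<^sub>0 k - c k)\<^sup>2) + (1 - a ^ Suc N) * l2_inner \<mu> g g"
      by (simp add: algebra_simps)
    finally show ?case .
  qed
qed

end

section \<open>The randomized algorithm\<close>

context orthonormal_system begin

text \<open>
  A combination of the \<open>b\<^sub>i\<close> is an isometric function of its coefficient vector, so preimages of open
  sets are open in the product topology, whose Borel sets are generated by the coordinates.
\<close>
lemma combination_measurable:
  assumes c: "\<And>k. k < r \<Longrightarrow> (\<lambda>\<omega>. c \<omega> k) \<in> borel_measurable M"
  shows "(\<lambda>\<omega> x. \<Sum>k<r. c \<omega> k * b k x) \<in> M \<rightarrow>\<^sub>M L2_borel \<mu>"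
  unfolding L2_borel_def
proof (rule measurable_measure_of, goal_cases)
  case 2
  show "(\<lambda>\<omega> x. \<Sum>k<r. c \<omega> k * b k x) \<in> space M \<rightarrow> L2 \<mu>"
    using b_L2 by (auto intro!: G.sum_in)
next
  case (3 U)
  then have U: "\<And>g. g \<in> U \<Longrightarrow> \<exists>e>0. \<forall>h\<in>L2 \<mu>. l2_norm \<mu> (\<lambda>x. h x - g x) < e \<longrightarrow> h \<in> U" by blast
  define T where "T v = (\<lambda>x. \<Sum>k<r. v k * b k x)" for v :: "nat \<Rightarrow> real"
  have T: "T v \<in> L2 \<mu>" for v unfolding T_def using b_L2 by (intro G.sum_in)
  have dist: "l2_norm \<mu> (\<lambda>x. T v x - T w x) = sqrt (\<Sum>k<r. (v k - w k)\<^sup>2)" for v w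
  proof -
    have "(\<lambda>x. T v x - T w x) = (\<lambda>x. 0 + (\<Sum>k<r. (v k - w k) * b k x))"
      by (simp add: T_def left_diff_distrib sum_subtractf)
    moreover have "l2_inner \<mu> (\<lambda>x. 0 + (\<Sum>k<r. (v k - w k) * b k x)) (\<lambda>x. 0 + (\<Sum>k<r. (v k - w k) * b k x))
        = l2_inner \<mu> (\<lambda>x. 0) (\<lambda>x. 0) + (\<Sum>k<r. (v k - w k)\<^sup>2)"
      by (rule G.norm_sq_orthogonal_add[OF b]) (use b_L2 G.zero_in G.zero_left in auto)
    ultimately show ?thesis by (simp add: l2_norm_def l2_inner_def)
  qed
  have "open {v. T v \<in> U}"
  proof (rule Topological_Spaces.openI)
    fix v assume "v \<in> {v. T v \<in> U}"
    with U[of "T v"] obtain e where e: "e > 0"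
      "\<And>h. h \<in> L2 \<mu> \<Longrightarrow> l2_norm \<mu> (\<lambda>x. h x - T v x) < e \<Longrightarrow> h \<in> U" by auto
    let ?V = "{w. sqrt (\<Sum>k<r. (w k - v k)\<^sup>2) < e}"
    have "open ?V"
      by (intro open_Collect_less continuous_intros continuous_on_product_coordinates)
    moreover have "v \<in> ?V" using e by simp
    moreover have "?V \<subseteq> {v. T v \<in> U}" using e(2)[OF T] dist by auto
    ultimately show "\<exists>V. open V \<and> v \<in> V \<and> V \<subseteq> {v. T v \<in> U}" by blast
  qed
  moreover have "(\<lambda>\<omega> k. if k < r then c \<omega> k else 0) \<in> borel_measurable M"
  proof (rule measurable_coordinatewise_then_product)
    show "(\<lambda>\<omega>. if i < r then c \<omega> i else 0) \<in> borel_measurable M" for i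
      using c[of i] by (cases "i < r") auto
  qed
  ultimately have "(\<lambda>\<omega> k. if k < r then c \<omega> k else 0) -` {v. T v \<in> U} \<inter> space M \<in> sets M"
    by (intro measurable_sets[OF _ borel_open])
  moreover have "T (\<lambda>k. if k < r then c \<omega> k else 0) = (\<lambda>x. \<Sum>k<r. c \<omega> k * b k x)" for \<omega>
    unfolding T_def by (intro ext sum.cong) auto
  ultimately show ?case
    by (simp add: vimage_def)
qed auto

definition coef :: "nat \<Rightarrow> (nat \<Rightarrow> 'x) \<times> (nat \<Rightarrow> 'x) \<Rightarrow> (nat \<Rightarrow> real) \<Rightarrow> nat \<Rightarrow> real" where
  "coef N \<omega> y = kaczmarz r b (snd \<omega>) (\<lambda>t. y (r + t)) (cramer_start r b (fst \<omega>) y) N"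

text \<open>
  The \<open>j\<close>-th sample point.  Beyond the last sample an arbitrary point of the domain serves as default,
  since an algorithm has to name a point after every list of observations.
\<close>
definition point :: "nat \<Rightarrow> (nat \<Rightarrow> 'x) \<times> (nat \<Rightarrow> 'x) \<Rightarrow> nat \<Rightarrow> 'x" where
  "point N \<omega> j = (if j < r then fst \<omega> j else if j < r + N then snd \<omega> (j - r) else (SOME x. x \<in> space \<mu>))"

text \<open>
  A nonadaptive algorithm of fixed cardinality \<open>r + N\<close>.
\<close>
definition sampler :: "nat \<Rightarrow> (nat \<Rightarrow> 'x) \<times> (nat \<Rightarrow> 'x) \<Rightarrow> 'x algorithm" where
  "sampler N \<omega> = Algorithm (\<lambda>ys f. f (point N \<omega> (length ys))) (\<lambda>ys. r + N \<le> length ys)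
     (\<lambda>ys x. if length ys = r + N then \<Sum>k<r. coef N \<omega> (\<lambda>j. ys ! j) k * b k x else 0)"

definition law :: "nat \<Rightarrow> ((nat \<Rightarrow> 'x) \<times> (nat \<Rightarrow> 'x)) measure" where
  "law N = \<pi> \<Otimes>\<^sub>M (\<Pi>\<^sub>M t\<in>{..<N}. \<nu>)"

lemma prob_space_law: "prob_space (law N)"
  unfolding law_def by (intro prob_space_pair prob_space_\<pi> prob_space_PiM prob_space_\<nu>)

lemma coef_cong: "(\<And>j. j < r + N \<Longrightarrow> y j = y' j) \<Longrightarrow> coef N \<omega> y = coef N \<omega> y'"
proof -
  assume eq: "\<And>j. j < r + N \<Longrightarrow> y j = y' j"
  then have "cramer_start r b (fst \<omega>) y = cramer_start r b (fst \<omega>) y'" by (intro cramer_start_cong) simp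
  then show ?thesis unfolding coef_def using eq by (auto intro!: kaczmarz_cong)
qed

lemma obs_sampler: "obs (sampler N \<omega>) f k = map (\<lambda>j. f (point N \<omega> j)) [0..<k]"
  by (induction k) (auto simp: sampler_def)

lemma cardinality_sampler: "cardinality (sampler N \<omega>) f = r + N"
  unfolding cardinality_def by (rule Least_equality) (auto simp: obs_sampler, simp_all add: sampler_def)

text \<open>
  On its own observations the output is the reconstruction from the values of \<open>f\<close> at the two groups
  of points; the error analysis works with this form.
\<close>
lemma run_sampler:
  "run (sampler N \<omega>) f = (\<lambda>x. \<Sum>k<r.
     kaczmarz r b (snd \<omega>) (\<lambda>t. f (snd \<omega> t)) (cramer_start r b (fst \<omega>) (\<lambda>j. f (fst \<omega> j))) N k * b k x)"
proof -
  have "coef N \<omega> (\<lambda>j. map (\<lambda>j. f (point N \<omega> j)) [0..<r + N] ! j) = coef N \<omega> (\<lambda>j. f (point N \<omega> j))"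
    by (rule coef_cong) (simp add: nth_append)
  also have "\<dots> = kaczmarz r b (snd \<omega>) (\<lambda>t. f (snd \<omega> t)) (cramer_start r b (fst \<omega>) (\<lambda>j. f (point N \<omega> j))) N"
    unfolding coef_def by (rule kaczmarz_cong) (simp add: point_def)
  also have "cramer_start r b (fst \<omega>) (\<lambda>j. f (point N \<omega> j)) = cramer_start r b (fst \<omega>) (\<lambda>j. f (fst \<omega> j))"
    by (rule cramer_start_cong) (simp add: point_def)
  finally show ?thesis unfolding run_def cardinality_sampler obs_sampler by (simp add: sampler_def)
qed

lemma point_in_space:
  assumes "\<omega> \<in> space (law N)" shows "point N \<omega> j \<in> space \<mu>"
  using assms someI_ex[of "\<lambda>x. x \<in> space \<mu>"] not_empty
  by (auto simp: law_def space_pair_measure space_\<pi> space_PiM point_def PiE_iff)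

lemma coef_measurable:
  assumes "\<omega> \<in> space (law N)" "k < r" "\<And>j. j < r + N \<Longrightarrow> (\<lambda>\<xi>. y \<xi> j) \<in> borel_measurable M"
  shows "(\<lambda>\<xi>. coef N \<omega> (y \<xi>) k) \<in> borel_measurable M"
  unfolding coef_def
proof (rule kaczmarz_measurable[where \<mu>=\<mu>])
  show "(\<lambda>\<xi>. snd \<omega> t) \<in> M \<rightarrow>\<^sub>M \<mu>" if "t < N" for t
    using point_in_space[OF assms(1), of "r + t"] that by (simp add: point_def)
  show "(\<lambda>\<xi>. cramer_start r b (fst \<omega>) (y \<xi>) i) \<in> borel_measurable M" for i
  proof (rule cramer_start_measurable[where \<mu>=\<mu>])
    show "(\<lambda>\<xi>. fst \<omega> j) \<in> M \<rightarrow>\<^sub>M \<mu>" if "j < r" for j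
      using point_in_space[OF assms(1), of j] that by (simp add: point_def)
  qed (use assms in auto)
qed (use assms in auto)

lemma det_algorithm_sampler:
  assumes \<omega>: "\<omega> \<in> space (law N)"
  shows "det_algorithm \<mu> F (Lambda_std (space \<mu>)) (sampler N \<omega>)"
  unfolding det_algorithm_def
proof (intro conjI allI ballI)
  show "query (sampler N \<omega>) ys \<in> Lambda_std (space \<mu>)" for ys
    using point_in_space[OF \<omega>] by (auto simp: sampler_def Lambda_std_def)
  show "\<exists>k. stop (sampler N \<omega>) (obs (sampler N \<omega>) f k)" for f
    unfolding obs_sampler by (intro exI[of _ "r + N"]) (simp add: sampler_def)
  show "(\<lambda>y. out (sampler N \<omega>) (map y [0..<k])) \<in> (\<Pi>\<^sub>M j\<in>{..<k}. borel) \<rightarrow>\<^sub>M L2_borel \<mu>" for k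
  proof (cases "k = r + N")
    case True
    have "coef N \<omega> (\<lambda>j. map y [0..<k] ! j) = coef N \<omega> y" for y
      using True by (intro coef_cong) (simp add: nth_append)
    then have "(\<lambda>y. out (sampler N \<omega>) (map y [0..<k])) = (\<lambda>y x. \<Sum>i<r. coef N \<omega> y i * b i x)"
      using True by (simp add: sampler_def)
    moreover have "(\<lambda>y. coef N \<omega> y i) \<in> borel_measurable (\<Pi>\<^sub>M j\<in>{..<k}. borel)" if "i < r" for i
      using True by (intro coef_measurable[OF \<omega> that] measurable_component_singleton) auto
    ultimately show ?thesis by (simp add: combination_measurable)
  next
    case False
    then have "(\<lambda>y. out (sampler N \<omega>) (map y [0..<k])) = (\<lambda>y x. \<Sum>i<r. 0 * b i x)"
      by (simp add: sampler_def)
    then show ?thesis using combination_measurable[of "\<lambda>_ _. 0"] by simp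
  qed
qed

text \<open>
  The residual \<open>g\<close> is orthogonal to the coefficient error, so the two parts add up as squares.
\<close>
lemma error_sampler:
  assumes f: "f \<in> L2 \<mu>"
  defines "c \<equiv> \<lambda>k. l2_inner \<mu> f (b k)" and "g \<equiv> residual (l2_inner \<mu>) r b f"
  shows "l2_norm \<mu> (\<lambda>x. f x - run (sampler N \<omega>) f x) = sqrt (l2_inner \<mu> g g + (\<Sum>k<r.
    (kaczmarz r b (snd \<omega>) (\<lambda>t. f (snd \<omega> t)) (cramer_start r b (fst \<omega>) (\<lambda>j. f (fst \<omega> j))) N k - c k)\<^sup>2))"
proof -
  let ?k = "kaczmarz r b (snd \<omega>) (\<lambda>t. f (snd \<omega> t)) (cramer_start r b (fst \<omega>) (\<lambda>j. f (fst \<omega> j))) N"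
  have "f x - (\<Sum>k<r. ?k k * b k x) = g x + (\<Sum>k<r. (c k - ?k k) * b k x)" for x
    by (simp add: g_def residual_def c_def left_diff_distrib sum_subtractf)
  then have "(\<lambda>x. f x - run (sampler N \<omega>) f x) = (\<lambda>x. g x + (\<Sum>k<r. (c k - ?k k) * b k x))"
    unfolding run_sampler by (rule ext)
  then have "l2_norm \<mu> (\<lambda>x. f x - run (sampler N \<omega>) f x) = sqrt (l2_inner \<mu> g g + (\<Sum>k<r. (c k - ?k k)\<^sup>2))"
    unfolding l2_norm_def g_def
    using G.norm_sq_orthogonal_add[OF b G.residual_in[OF b f] G.residual_orthogonal[OF b f], of "\<lambda>k. c k - ?k k"]
    by simp
  then show ?thesis by (simp add: power2_commute)
qed

lemma coefficients_measurable:
  assumes fm: "f \<in> borel_measurable \<mu>" and k: "k < r"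
  shows "(\<lambda>\<omega>. kaczmarz r b (snd \<omega>) (\<lambda>t. f (snd \<omega> t)) (cramer_start r b (fst \<omega>) (\<lambda>j. f (fst \<omega> j))) N k)
    \<in> borel_measurable (law N)"
proof -
  have fst: "(\<lambda>\<omega>. fst \<omega> j) \<in> law N \<rightarrow>\<^sub>M \<mu>" if "j < r" for j
  proof -
    have "fst \<in> law N \<rightarrow>\<^sub>M (\<Pi>\<^sub>M j\<in>{..<r}. \<mu>)"
      unfolding law_def using measurable_fst[of \<pi>] by (simp cong: measurable_cong_sets)
    from measurable_compose[OF this measurable_component_singleton[of j]] that show ?thesis by simp
  qed
  have snd: "(\<lambda>\<omega>. snd \<omega> t) \<in> law N \<rightarrow>\<^sub>M \<mu>" if "t < N" for t
  proof -
    have "snd \<in> law N \<rightarrow>\<^sub>M (\<Pi>\<^sub>M t\<in>{..<N}. \<nu>)" unfolding law_def by (rule measurable_snd)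
    from measurable_compose[OF this measurable_component_singleton[of t]] that
    show ?thesis by (simp cong: measurable_cong_sets)
  qed
  show ?thesis
    by (rule kaczmarz_measurable[where \<mu>=\<mu>, OF _ snd measurable_compose[OF snd fm] _ k])
      (auto intro!: cramer_start_measurable[where \<mu>=\<mu>, OF _ fst measurable_compose[OF fst fm]])
qed

text \<open>
  Three contributions: \<open>\<parallel>g\<parallel>\<^sup>2\<close> from the distance of \<open>f\<close> to the span, at most \<open>\<parallel>g\<parallel>\<^sup>2\<close> from the noise of
  the Kaczmarz steps, and the contracted interpolation error \<open>r a\<^sup>N \<parallel>g\<parallel>\<^sup>2\<close>.
\<close>
lemma expected_error_sampler:
  assumes f: "f \<in> L2 \<mu>"
  defines "g \<equiv> residual (l2_inner \<mu>) r b f"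
  shows "(\<integral>\<^sup>+\<omega>. ennreal ((l2_norm \<mu> (\<lambda>x. f x - run (sampler N \<omega>) f x))\<^sup>2) \<partial>law N)
    \<le> ennreal ((2 + r * (1 - 1 / (1 + real r)) ^ N) * l2_inner \<mu> g g)"
proof -
  interpret P: prob_space "\<Pi>\<^sub>M t\<in>{..<N}. \<nu>" by (rule prob_space_PiM) (rule prob_space_\<nu>)
  interpret \<pi>: prob_space \<pi> by (rule prob_space_\<pi>)
  interpret law: prob_space "law N" by (rule prob_space_law)
  define c where "c k = l2_inner \<mu> f (b k)" for k
  define a where "a = 1 - 1 / (1 + real r)"
  have a: "0 \<le> a" "a \<le> 1" by (auto simp: a_def field_simps)
  have aN: "0 \<le> a ^ N" "a ^ N \<le> 1" using a by (auto intro: power_le_one)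
  let ?G = "l2_inner \<mu> g g"
  have G0: "?G \<ge> 0" by (simp add: l2_inner_def)
  have fm: "f \<in> borel_measurable \<mu>" using f by (simp add: L2_def)
  let ?s = "\<lambda>x. cramer_start r b x (\<lambda>j. f (x j))"
  let ?e = "\<lambda>x z. \<Sum>k<r. (kaczmarz r b z (\<lambda>t. f (z t)) (?s x) N k - c k)\<^sup>2"
  let ?d = "\<lambda>x. \<Sum>k<r. (?s x k - c k)\<^sup>2"
  have e0: "?e x z \<ge> 0" "?d x \<ge> 0" for x z by (auto intro!: sum_nonneg)
  have em: "(\<lambda>\<omega>. ?e (fst \<omega>) (snd \<omega>)) \<in> borel_measurable (law N)"
    by (intro borel_measurable_sum borel_measurable_power borel_measurable_diff coefficients_measurable[OF fm]) auto
  have dm: "(\<lambda>x. ennreal (?d x)) \<in> borel_measurable \<pi>"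
  proof -
    have "(\<lambda>x. x j) \<in> \<pi> \<rightarrow>\<^sub>M \<mu>" if "j < r" for j
      using measurable_component_singleton[of j "{..<r}" "\<lambda>_. \<mu>"] that by (simp cong: measurable_cong_sets)
    note this measurable_compose[OF this fm]
    then have "(\<lambda>x. ?s x k) \<in> borel_measurable \<pi>" for k
      by (intro cramer_start_measurable[where \<mu>=\<mu>]) auto
    then show ?thesis
      by (intro measurable_compose[OF _ measurable_ennreal] borel_measurable_sum
          borel_measurable_power borel_measurable_diff) auto
  qed
  have affine: "(\<integral>\<^sup>+x. \<alpha> * h x + \<beta> \<partial>\<pi>) = \<alpha> * (\<integral>\<^sup>+x. h x \<partial>\<pi>) + \<beta>"
    if "h \<in> borel_measurable \<pi>" for h \<alpha> \<beta>
    using that by (simp add: nn_integral_add nn_integral_cmult \<pi>.emeasure_space_1)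
  have "(\<integral>\<^sup>+\<omega>. ennreal (?e (fst \<omega>) (snd \<omega>)) \<partial>law N)
      = (\<integral>\<^sup>+x. (\<integral>\<^sup>+z. ennreal (?e x z) \<partial>(\<Pi>\<^sub>M t\<in>{..<N}. \<nu>)) \<partial>\<pi>)"
    unfolding law_def using em[unfolded law_def]
    by (subst P.nn_integral_fst[symmetric]) auto
  also have "\<dots> \<le> (\<integral>\<^sup>+x. ennreal (a ^ N) * ennreal (?d x) + ennreal ?G \<partial>\<pi>)"
  proof (rule nn_integral_mono)
    fix x
    have "(\<integral>\<^sup>+z. ennreal (?e x z) \<partial>(\<Pi>\<^sub>M t\<in>{..<N}. \<nu>)) \<le> ennreal (a ^ N * ?d x + (1 - a ^ N) * ?G)"
      using kaczmarz_expectation[OF f, where c\<^sub>0="?s x" and N=N] by (simp add: c_def g_def a_def)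
    also have "\<dots> \<le> ennreal (a ^ N * ?d x + ?G)"
      using aN G0 by (intro ennreal_leI add_left_mono) (simp add: mult_left_le_one_le)
    also have "\<dots> = ennreal (a ^ N) * ennreal (?d x) + ennreal ?G"
      using aN G0 e0(2)[of x] by (simp add: ennreal_plus ennreal_mult)
    finally show "(\<integral>\<^sup>+z. ennreal (?e x z) \<partial>(\<Pi>\<^sub>M t\<in>{..<N}. \<nu>)) \<le> ennreal (a ^ N) * ennreal (?d x) + ennreal ?G" .
  qed
  also have "\<dots> = ennreal (a ^ N) * (\<integral>\<^sup>+x. ennreal (?d x) \<partial>\<pi>) + ennreal ?G"
    by (rule affine[OF dm])
  also have "\<dots> \<le> ennreal (a ^ N) * ennreal (r * ?G) + ennreal ?G"
    using cramer_start_expectation[OF f] by (intro add_right_mono mult_left_mono) (auto simp: c_def g_def)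
  finally have e_le: "(\<integral>\<^sup>+\<omega>. ennreal (?e (fst \<omega>) (snd \<omega>)) \<partial>law N)
      \<le> ennreal (a ^ N) * ennreal (r * ?G) + ennreal ?G" .
  have "(\<integral>\<^sup>+\<omega>. ennreal ((l2_norm \<mu> (\<lambda>x. f x - run (sampler N \<omega>) f x))\<^sup>2) \<partial>law N)
      = (\<integral>\<^sup>+\<omega>. ennreal ?G + ennreal (?e (fst \<omega>) (snd \<omega>)) \<partial>law N)"
    using G0 e0 by (intro nn_integral_cong) (simp add: error_sampler[OF f] g_def c_def ennreal_plus add_nonneg_nonneg)
  also have "\<dots> = ennreal ?G + (\<integral>\<^sup>+\<omega>. ennreal (?e (fst \<omega>) (snd \<omega>)) \<partial>law N)"
    using em by (subst nn_integral_add) (auto simp: law.emeasure_space_1)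
  also have "\<dots> \<le> ennreal ?G + (ennreal (a ^ N) * ennreal (r * ?G) + ennreal ?G)"
    by (intro add_left_mono e_le)
  also have "\<dots> = ennreal ((2 + r * a ^ N) * ?G)"
  proof -
    have "ennreal (a ^ N) * ennreal (r * ?G) = ennreal (a ^ N * (r * ?G))"
      using aN by (simp add: ennreal_mult')
    then show ?thesis using aN G0 by (simp add: ennreal_plus[symmetric] algebra_simps del: ennreal_plus)
  qed
  finally show ?thesis by (simp add: a_def)
qed

proposition e_ran_sampler_le:
  fixes F :: "('x \<Rightarrow> real) set"
  assumes F: "F \<subseteq> L2 \<mu>"
    and e: "\<And>f. f \<in> unit_ball F ip \<Longrightarrow> l2_norm \<mu> (residual (l2_inner \<mu>) r b f) \<le> e"
    and N: "r * (1 - 1 / (1 + real r)) ^ N \<le> 2" and n: "r + N \<le> n" and e0: "e \<ge> 0"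
  shows "e_ran \<mu> F ip (Lambda_std (space \<mu>)) n \<le> ennreal (2 * e)"
proof -
  interpret law: prob_space "law N" by (rule prob_space_law)
  have "ran_algorithm \<mu> F (Lambda_std (space \<mu>)) (law N) (sampler N)"
    unfolding ran_algorithm_def
  proof (intro conjI ballI prob_space_law det_algorithm_sampler)
    fix f assume "f \<in> F"
    then have f: "f \<in> L2 \<mu>" using F by auto
    then have fm: "f \<in> borel_measurable \<mu>" by (simp add: L2_def)
    show "(\<lambda>\<omega>. cardinality (sampler N \<omega>) f) \<in> law N \<rightarrow>\<^sub>M count_space UNIV"
      by (simp add: cardinality_sampler)
    show "(\<lambda>\<omega>. l2_norm \<mu> (\<lambda>x. f x - run (sampler N \<omega>) f x)) \<in> borel_measurable (law N)"
      unfolding error_sampler[OF f]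
      by (intro measurable_compose[OF _ borel_measurable_sqrt] borel_measurable_add borel_measurable_sum
          borel_measurable_power borel_measurable_diff coefficients_measurable[OF fm]) auto
  qed
  moreover have "ran_card F ip (law N) (sampler N) \<le> of_nat n"
    unfolding ran_card_def cardinality_sampler using n
    by (intro SUP_least) (simp add: law.emeasure_space_1 del: of_nat_add)
  ultimately have "e_ran \<mu> F ip (Lambda_std (space \<mu>)) n \<le> ran_error \<mu> F ip (law N) (sampler N)"
    by (rule e_ran_le)
  also have "\<dots> \<le> ennreal (2 * e)"
    unfolding ran_error_def
  proof (rule SUP_least)
    fix f assume fb: "f \<in> unit_ball F ip"
    then have f: "f \<in> L2 \<mu>" using F by (auto simp: unit_ball_def)
    let ?g = "residual (l2_inner \<mu>) r b f"
    let ?I = "\<integral>\<^sup>+\<omega>. ennreal ((l2_norm \<mu> (\<lambda>x. f x - run (sampler N \<omega>) f x))\<^sup>2) \<partial>law N"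
    have G: "0 \<le> l2_inner \<mu> ?g ?g" by (simp add: l2_inner_def)
    have "sqrt (l2_inner \<mu> ?g ?g) \<le> e" using e[OF fb] by (simp add: l2_norm_def)
    then have "l2_inner \<mu> ?g ?g \<le> e\<^sup>2" by (rule sqrt_le_D)
    then have "(2 + r * (1 - 1 / (1 + real r)) ^ N) * l2_inner \<mu> ?g ?g \<le> 4 * e\<^sup>2"
      using N G by (intro mult_mono) auto
    with expected_error_sampler[OF f, of N] have I: "?I \<le> ennreal ((2 * e)\<^sup>2)"
      by (auto simp: power_mult_distrib intro: order_trans ennreal_leI)
    then have fin: "?I \<noteq> \<top>" by (auto simp: top_unique)
    have "enn2real ?I \<le> (2 * e)\<^sup>2" using I by (intro enn2real_leI) auto
    then have "sqrt (enn2real ?I) \<le> 2 * e" using e0 by (intro real_le_lsqrt) auto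
    with fin show "ennreal_sqrt ?I \<le> ennreal (2 * e)" by (simp add: ennreal_sqrt_def ennreal_leI)
  qed
  finally show ?thesis .
qed

end

section \<open>Sample budget and main result\<close>

lemma (in approximation_setting) prob_space_weighted_measure: "prob_space \<mu>"
  and space_weighted_measure: "space \<mu> = D"
proof -
  show sp: "space \<mu> = D" by (simp add: weighted_measure_def)
  show "prob_space \<mu>"
  proof (rule prob_spaceI)
    have "emeasure \<mu> (space \<mu>) = (\<integral>\<^sup>+x. ennreal (\<rho> x) * indicator D x \<partial>lebesgue_on D)"
      unfolding sp unfolding weighted_measure_def
      using \<rho>_measurable sets.top[of "lebesgue_on D"] by (intro emeasure_density) auto
    also have "\<dots> = (\<integral>\<^sup>+x. ennreal (\<rho> x) \<partial>lebesgue_on D)"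
      by (intro nn_integral_cong) (simp add: indicator_def)
    finally show "emeasure \<mu> (space \<mu>) = 1" using \<rho>_integral by simp
  qed
qed

text \<open>
  Of the \<open>n\<close> samples at most \<open>m\<close> are spent on interpolation.  The remaining number is at least
  \<open>(1 + r) ln (4n)\<close>, so that \<open>a\<^bsup>n-r\<^esup> \<le> exp (- ln (4n)) = 1/(4n)\<close>.
\<close>
lemma sample_budget:
  fixes m n r :: nat
  assumes m: "m \<ge> 1" and n: "n \<ge> 1"
    and mn: "real m \<le> real n / (48 * sqrt 2 * ln (4 * real n))" and r: "r \<le> m"
  shows "r \<le> n" and "r * (1 - 1 / (1 + real r)) ^ (n - r) \<le> 1"
proof -
  define l where "l = ln (4 * real n)"
  have l: "l \<ge> 1"
  proof -
    have "exp 1 \<le> 4 * real n" using exp_le n by (simp add: order_trans[of _ 3])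
    then show ?thesis using n by (simp add: l_def ln_ge_iff)
  qed
  have "48 * l * real m \<le> 48 * sqrt 2 * l * real m"
    using l by (intro mult_right_mono) auto
  also have "\<dots> \<le> real n" using mn l unfolding l_def[symmetric] by (simp add: field_simps)
  finally have big: "48 * l * real m \<le> real n" .
  have lm: "real m \<le> l * real m" using mult_right_mono[OF l, of "real m"] by simp
  have "real r \<le> real n" using r lm big by linarith
  then show rn: "r \<le> n" by simp
  have "(1 + real r) * l \<le> 2 * real m * l" using m r l by (intro mult_right_mono) auto
  also have "\<dots> \<le> real n - real m" using big lm by (simp add: mult_ac)
  also have "\<dots> \<le> real (n - r)" using r rn by (simp add: of_nat_diff)
  finally have N: "l \<le> real (n - r) / (1 + real r)" by (simp add: field_simps)
  have "(1 - 1 / (1 + real r)) ^ (n - r) \<le> exp (- (1 / (1 + real r))) ^ (n - r)"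
    using exp_ge_add_one_self[of "- (1 / (1 + real r))"] by (intro power_mono) (auto simp: field_simps)
  also have "\<dots> = exp (- (real (n - r) / (1 + real r)))"
    by (simp add: exp_of_nat_mult[symmetric])
  also have "\<dots> \<le> exp (- l)" using N by simp
  also have "\<dots> = 1 / (4 * real n)" using n by (simp add: l_def exp_minus inverse_eq_divide)
  finally have "r * (1 - 1 / (1 + real r)) ^ (n - r) \<le> real r * (1 / (4 * real n))"
    by (intro mult_left_mono) auto
  also have "\<dots> \<le> 1" using rn n by (simp add: field_simps)
  finally show "r * (1 - 1 / (1 + real r)) ^ (n - r) \<le> 1" .
qed

text \<open>
  The infimum defining the worst case error need not be attained, so the bound is shown for every
  larger number \<open>s\<close> and the limit is taken.
\<close>
proposition (in approximation_setting) e_ran_le_twice_e_wor: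
  assumes "m \<ge> 1" "n \<ge> 1" "real m \<le> real n / (48 * sqrt 2 * ln (4 * real n))"
  shows "e_ran \<mu> F ip (Lambda_std D) n \<le> 2 * e_wor \<mu> F ip m"
proof (cases "e_wor \<mu> F ip m = \<top>")
  case True
  then show ?thesis by (simp add: ennreal_mult_top)
next
  case False
  define w where "w = enn2real (e_wor \<mu> F ip m)"
  have w: "e_wor \<mu> F ip m = ennreal w" "w \<ge> 0" using False by (auto simp: w_def less_top)
  have le: "e_ran \<mu> F ip (Lambda_std D) n \<le> ennreal (2 * s)" if s: "s > w" for s
  proof -
    have "e_wor \<mu> F ip m < ennreal s" using w s by (simp add: ennreal_less_iff)
    then obtain r b where r: "r \<le> m" and b: "orthonormal (L2 \<mu>) (l2_inner \<mu>) r b"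
      and res: "\<And>f. f \<in> unit_ball F ip \<Longrightarrow> l2_norm \<mu> (residual (l2_inner \<mu>) r b f) \<le> s"
      using best_subspace by blast
    interpret orthonormal_system \<mu> r b
      by (intro orthonormal_system.intro prob_space_weighted_measure orthonormal_system_axioms.intro b)
    note budget = sample_budget[OF assms r]
    have "e_ran \<mu> F ip (Lambda_std (space \<mu>)) n \<le> ennreal (2 * s)"
      using budget w s by (intro e_ran_sampler_le[OF F_subset res, where N="n - r"]) auto
    then show ?thesis by (simp add: space_weighted_measure)
  qed
  have "e_ran \<mu> F ip (Lambda_std D) n \<le> ennreal (2 * w)"
  proof (rule ennreal_le_epsilon)
    fix e :: real assume e: "e > 0"
    have "e_ran \<mu> F ip (Lambda_std D) n \<le> ennreal (2 * (w + e / 2))" by (rule le) (use e in simp)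
    also have "2 * (w + e / 2) = 2 * w + e" by simp
    finally show "e_ran \<mu> F ip (Lambda_std D) n \<le> ennreal (2 * w) + ennreal e"
      using w e by (simp add: ennreal_plus)
  qed
  then show ?thesis using w by (simp add: ennreal_mult)
qed

theorem theorem5p1:
  fixes D :: "(real ^ 'd) set"
    and \<rho> :: "real ^ 'd \<Rightarrow> real"
    and F :: "(real ^ 'd \<Rightarrow> real) set"
    and ip :: "(real ^ 'd \<Rightarrow> real) \<Rightarrow> (real ^ 'd \<Rightarrow> real) \<Rightarrow> real"
    and m n :: nat
  assumes "approximation_setting D \<rho> F ip"
    and "m \<ge> 1" and "n \<ge> 1"
    and "int m = \<lfloor>real n / (48 * sqrt 2 * ln (4 * real n))\<rfloor>"
  shows "e_ran (weighted_measure D \<rho>) F ip (Lambda_std D) n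
           \<le> 4 * e_wor (weighted_measure D \<rho>) F ip m \<and>
         (\<forall>A q :: real. A \<ge> 1 \<longrightarrow> 0 < q \<longrightarrow> q < 1 \<longrightarrow>
            (\<forall>k\<ge>1. e_wor (weighted_measure D \<rho>) F ip k
                \<le> ennreal (A * q ^ (k + 1) * sqrt (lambda1 (weighted_measure D \<rho>) F ip))) \<longrightarrow>
            (let q2 = q powr (1 / (48 * sqrt 2)) in
               q < q2 \<and> q2 < 1 \<and>
               e_ran (weighted_measure D \<rho>) F ip (Lambda_std D) n
                 \<le> ennreal (4 * A * q2 powr (real n / ln (4 * real n))
                      * sqrt (lambda1 (weighted_measure D \<rho>) F ip))))"
proof -
  interpret approximation_setting D \<rho> F ip by fact
  define t where "t = real n / (48 * sqrt 2 * ln (4 * real n))"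
  have t: "real m \<le> t" "t < real m + 1" using assms(4) unfolding t_def by linarith+
  have "e_ran \<mu> F ip (Lambda_std D) n \<le> 2 * e_wor \<mu> F ip m"
    using e_ran_le_twice_e_wor assms(2,3) t(1) unfolding t_def .
  also have "\<dots> \<le> 4 * e_wor \<mu> F ip m" by (intro mult_right_mono) auto
  finally have main: "e_ran \<mu> F ip (Lambda_std D) n \<le> 4 * e_wor \<mu> F ip m" .
  have "q < q powr (1 / (48 * sqrt 2)) \<and> q powr (1 / (48 * sqrt 2)) < 1 \<and>
      e_ran \<mu> F ip (Lambda_std D) n
        \<le> ennreal (4 * A * (q powr (1 / (48 * sqrt 2))) powr (real n / ln (4 * real n))
             * sqrt (lambda1 \<mu> F ip))"
    if A: "A \<ge> 1" and q: "0 < q" "q < 1"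
      and decay: "\<forall>k\<ge>1. e_wor \<mu> F ip k \<le> ennreal (A * q ^ (k + 1) * sqrt (lambda1 \<mu> F ip))" for A q
  proof (intro conjI)
    let ?s = "sqrt (lambda1 \<mu> F ip)"
    have "sqrt 2 \<ge> (1::real)" by simp
    then have "48 * sqrt 2 > (1::real)" by linarith
    then have ex: "1 / (48 * sqrt 2) < (1::real)" "1 / (48 * sqrt 2) > (0::real)" by auto
    show "q < q powr (1 / (48 * sqrt 2))" using powr_less_mono'[OF q ex(1)] q by simp
    show "q powr (1 / (48 * sqrt 2)) < 1" using powr_less_mono'[OF q ex(2)] q by simp
    have "q ^ (m + 1) = q powr (real m + 1)" using q by (simp add: powr_add powr_realpow)
    also have "\<dots> \<le> q powr t" using t(2) q by (intro powr_mono') auto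
    also have "\<dots> = (q powr (1 / (48 * sqrt 2))) powr (real n / ln (4 * real n))"
      by (simp add: powr_powr t_def)
    finally have pow: "q ^ (m + 1) \<le> (q powr (1 / (48 * sqrt 2))) powr (real n / ln (4 * real n))" .
    have "4 * e_wor \<mu> F ip m \<le> 4 * ennreal (A * q ^ (m + 1) * ?s)"
      using decay assms(2) by (intro mult_left_mono) auto
    also have "\<dots> = ennreal (4 * (A * q ^ (m + 1) * ?s))" by (simp add: ennreal_mult')
    also have "\<dots> \<le> ennreal (4 * A * (q powr (1 / (48 * sqrt 2))) powr (real n / ln (4 * real n)) * ?s)"
    \<comment> \<open>The real square root of a negative number is negative; then both bounds collapse to zero.\<close>
    proof (cases "?s \<ge> 0")
      case True
      then have "A * q ^ (m + 1) * ?s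
          \<le> A * (q powr (1 / (48 * sqrt 2))) powr (real n / ln (4 * real n)) * ?s"
        using A pow by (intro mult_right_mono mult_left_mono) auto
      then show ?thesis by (intro ennreal_leI) simp
    next
      case False
      then have "4 * (A * q ^ (m + 1) * ?s) \<le> 0"
        using A q by (simp add: mult_nonneg_nonpos)
      then show ?thesis by (simp add: ennreal_neg)
    qed
    finally show "e_ran \<mu> F ip (Lambda_std D) n
        \<le> ennreal (4 * A * (q powr (1 / (48 * sqrt 2))) powr (real n / ln (4 * real n)) * ?s)"
      using main by (rule order_trans[rotated])
  qed
  with main show ?thesis by (simp only: Let_def) blast
qed

end
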